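(* Let $\theta=\cot^{-1}\sqrt{7}$. For every integer $k\ge 1$, $$\begin{aligned}\zeta(4k-1)=\;&(2\pi)^{4k-1}\sum_{j=0}^k \frac{(-1)^{j+1}\, c_{jk}\, B_{2j}\, B_{4k-2j}}{(2j)!\,(4k-2j)!}+\frac{b_k}{a_k}\,\mathcal{L}_{e^{-\sqrt{7}\pi}}(-4k+1)\\&-\frac{(2^{-4k+2}+2)\,b_k-2^{-2k+2}}{a_k}\,\mathcal{L}_{e^{-2\sqrt{7}\pi}}(-4k+1)\\&+\frac{2^{-4k+2}\,b_k}{a_k}\,\mathcal{L}_{e^{-4\sqrt{7}\pi}}(-4k+1),\end{aligned}$$ where $$a_k=2^{2k}+2\cos[(4k-2)\theta],$$ $$b_k=2^{2k+1}+2^{-2k+2}+2^{\frac32}\sin[(4k+1)\theta]+2\cos(4k\theta),$$ $$c_{jk}=\frac{2^{2k+\frac12-j}\cos[(2j-1)\theta]+2^{j+\frac12}\cos[(4k-1-2j)\theta]}{a_k\,(1+\delta_{jk})}.$$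
   Context: For complex $q$ with $|q|<1$ and $s\in\mathbb{C}$, the Lambert series is $\mathcal{L}_q(s)=\sum_{n=1}^\infty \frac{n^s q^n}{1-q^n}$. $\zeta$ is the Riemann zeta function, $B_m$ is the $m$th Bernoulli number, and $\delta_{jk}$ is the Kronecker delta. $\cot^{-1}\sqrt{7}$ denotes the angle in $(0,\pi/2)$ whose cotangent is $\sqrt{7}$. *)

theory Defs
  imports "HOL-Analysis.Analysis" "HOL-Computational_Algebra.Formal_Power_Series"
begin

(* The Dirichlet series of the Riemann zeta function. It agrees with the zeta function for
   Re s > 1; no analytic continuation is built in. *)
definition zeta :: "complex \<Rightarrow> complex" where
  "zeta s = (\<Sum>n. of_nat (Suc n) powr (- s))"

(* Meaningful for norm q < 1. The summation index is shifted, so that n = Suc m. *)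
definition lambert_series :: "complex \<Rightarrow> complex \<Rightarrow> complex" where
  "lambert_series q s =
     (\<Sum>m. of_nat (Suc m) powr s * q ^ Suc m / (1 - q ^ Suc m))"

(* Exponential generating function t / (exp t - 1); in this convention B_1 = -1/2. *)
definition bernoulli :: "nat \<Rightarrow> real" where
  "bernoulli n = fact n * fps_nth (fps_X / (fps_exp 1 - 1)) n"

lemma bernoulli_egf:
  "Abs_fps (\<lambda>n. bernoulli n / fact n) * (fps_exp 1 - 1) = (fps_X :: real fps)"
proof -
  let ?g = "fps_exp 1 - 1 :: real fps"
  have g1: "fps_nth ?g 1 \<noteq> 0" and g0: "fps_nth ?g 0 = 0" by simp_all
  have nz: "?g \<noteq> 0" using g1 by (metis fps_zero_nth)
  have "subdegree ?g = 1"
    by (rule subdegreeI) (use g1 g0 in auto)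
  hence "?g dvd fps_X" using nz by (simp add: fps_dvd_iff)
  moreover have "Abs_fps (\<lambda>n. bernoulli n / fact n) = fps_X / ?g"
    by (simp add: bernoulli_def fps_eq_iff)
  ultimately show ?thesis by simp
qed

definition coeff_a :: "real \<Rightarrow> nat \<Rightarrow> real" where
  "coeff_a \<theta> k = 2 ^ (2 * k) + 2 * cos ((4 * real k - 2) * \<theta>)"

definition coeff_b :: "real \<Rightarrow> nat \<Rightarrow> real" where
  "coeff_b \<theta> k =
     2 ^ (2 * k + 1) + 2 powi (- 2 * int k + 2)
     + 2 powr (3 / 2) * sin ((4 * real k + 1) * \<theta>) + 2 * cos (4 * real k * \<theta>)"

definition coeff_c :: "real \<Rightarrow> nat \<Rightarrow> nat \<Rightarrow> real" where
  "coeff_c \<theta> j k =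
     (2 powr (2 * real k + 1 / 2 - real j) * cos ((2 * real j - 1) * \<theta>)
      + 2 powr (real j + 1 / 2) * cos ((4 * real k - 1 - 2 * real j) * \<theta>))
     / (coeff_a \<theta> k * (1 + of_bool (j = k)))"

end

theory Submission
  imports Defs
begin

text \<open>
  Write \<open>F \<tau>\<close> for the Lambert series at \<open>q = exp (2 \<pi> \<i> \<tau>)\<close> and exponent \<open>- m\<close>, where \<open>m = 4 k - 1\<close>.
  Since \<open>q / (1 - q) = (\<i> cot (\<pi> \<tau>) - 1) / 2\<close>, it equals \<open>(\<i> C \<tau> - \<zeta> m) / 2\<close> with
  \<open>C \<tau> = \<Sum>n. cot (\<pi> n \<tau>) / n ^ m\<close>. Expanding the cotangent into partial fractions
  turns \<open>C \<tau> + \<tau> ^ (m - 1) C (1 / \<tau>)\<close> into a double sum over \<open>(n, j)\<close> whose terms are finite geometric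
  sums, so it is a polynomial in \<open>\<tau>\<close> and \<open>1 / \<tau>\<close> with coefficients \<open>\<zeta> (2 i) \<zeta> (m + 1 - 2 i)\<close>: this is
  Ramanujan's formula, relating \<open>F \<tau>\<close> and \<open>F (- 1 / \<tau>)\<close>. Take \<open>\<alpha> = (1 + \<i> sqrt 7) / 2\<close> and
  \<open>v = - 1 / \<alpha> = \<i> exp (\<i> \<theta>) / sqrt 2\<close>. The nome \<open>x\<close> of \<open>v\<close> is purely imaginary, so the duplication
  formula \<open>L x + L (- x) = (2 + 2 / 2 ^ m) L (x^2) - 2 / 2 ^ m L (x^4)\<close> evaluates
  \<open>2 Re (F v)\<close> through \<open>F \<alpha>\<close> and \<open>F (2 \<alpha>)\<close>; comparison with the real part of Ramanujan's
  formula at \<open>v\<close> gives \<open>\<zeta> m\<close>. A second duplication, from the nome \<open>exp (- sqrt 7 \<pi>)\<close>, removes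
  \<open>F \<alpha>\<close>, whose nome is negative.
\<close>

subsection \<open>Partial fractions of the cotangent\<close>

text \<open>Logarithmic derivative of Euler's reflection formula. Working with \<open>rGamma\<close>
  keeps both sides entire, so the product can be differentiated directly and division is postponed
  to the point where the sine is known to be nonzero.\<close>

lemma Digamma_reflection:
  fixes z :: complex
  assumes z: "z \<notin> \<int>"
  shows "Digamma (1 - z) - Digamma z = of_real pi * cot (of_real pi * z)"
proof -
  have z': "1 - z \<notin> \<int>"
    using z Ints_diff[of 1 "1 - z"] by auto
  have np: "z \<notin> \<int>\<^sub>\<le>\<^sub>0" "1 - z \<notin> \<int>\<^sub>\<le>\<^sub>0"
    using z z' nonpos_Ints_Int by auto
  have sin_nz: "sin (of_real pi * z) \<noteq> 0"
    using z by (auto simp: sin_eq_0)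
  have refl: "rGamma w * rGamma (1 - w) = sin (of_real pi * w) / of_real pi" for w :: complex
    by (rule rGamma_reflection_complex)
  have "((\<lambda>w. rGamma w * rGamma (1 - w)) has_field_derivative
           (rGamma z * rGamma (1 - z)) * (Digamma (1 - z) - Digamma z)) (at z)"
    using np by (auto intro!: derivative_eq_intros simp: algebra_simps)
  moreover have "((\<lambda>w. sin (of_real pi * w) / of_real pi) has_field_derivative
           cos (of_real pi * z)) (at z)"
    by (auto intro!: derivative_eq_intros)
  ultimately have "(rGamma z * rGamma (1 - z)) * (Digamma (1 - z) - Digamma z) = cos (of_real pi * z)"
    unfolding refl using DERIV_unique by blast
  thus ?thesis
    unfolding refl using sin_nz by (simp add: cot_def field_simps)
qed

text \<open>Subtract the \<open>Digamma\<close> series at \<open>1 + z\<close> from the one at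
  \<open>1 - z\<close>: the harmonic terms and the Euler constants cancel, and the poles at
  \<open>Suc n\<close> and \<open>- Suc n\<close> pair up. The term \<open>1 / z\<close> comes from
  the recurrence for \<open>Digamma (1 + z)\<close>.\<close>

lemma cot_partial_fractions:
  fixes z :: complex
  assumes z: "z \<notin> \<int>"
  shows "(\<lambda>n. 2 * z / (z\<^sup>2 - (of_nat (Suc n))\<^sup>2)) sums (of_real pi * cot (of_real pi * z) - 1 / z)"
proof -
  have "z \<noteq> 0" using z by auto
  have nz: "1 - z + of_nat n \<noteq> 0" "1 + z + of_nat n \<noteq> 0" for n
  proof -
    show "1 - z + of_nat n \<noteq> 0"
    proof
      assume "1 - z + of_nat n = 0"
      hence "z = of_nat (Suc n)" by (simp add: algebra_simps)
      thus False using z by simp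
    qed
    show "1 + z + of_nat n \<noteq> 0"
    proof
      assume "1 + z + of_nat n = 0"
      hence "z = - of_nat (Suc n)" by (simp add: algebra_simps eq_neg_iff_add_eq_0)
      thus False using z by (metis Ints_minus Ints_of_nat)
    qed
  qed
  have D: "(\<lambda>n. inverse (of_nat (Suc n)) - inverse (w + of_nat n)) sums (Digamma w + euler_mascheroni)"
    if "w \<noteq> 0" for w :: complex
    using summable_sums[OF summable_Digamma[OF that]] by (simp add: Digamma_def)
  have "(\<lambda>n. (inverse (of_nat (Suc n)) - inverse (1 - z + of_nat n))
           - (inverse (of_nat (Suc n)) - inverse (1 + z + of_nat n)))
          sums ((Digamma (1 - z) + euler_mascheroni) - (Digamma (1 + z) + euler_mascheroni))"
    using nz[of 0] by (intro sums_diff D) simp_all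
  moreover have "Digamma (1 + z) = Digamma z + 1 / z"
    using Digamma_plus1[OF \<open>z \<noteq> 0\<close>] by (simp add: add.commute)
  ultimately have *: "(\<lambda>n. inverse (1 + z + of_nat n) - inverse (1 - z + of_nat n))
          sums (of_real pi * cot (of_real pi * z) - 1 / z)"
    using Digamma_reflection[OF z] by (simp add: algebra_simps)
  have "inverse (1 + z + of_nat n) - inverse (1 - z + of_nat n) = 2 * z / (z\<^sup>2 - (of_nat (Suc n))\<^sup>2)" for n
  proof -
    have e: "z\<^sup>2 - (of_nat (Suc n))\<^sup>2 = - ((1 + z + of_nat n) * (1 - z + of_nat n))"
      by (simp add: power2_eq_square algebra_simps)
    have "inverse (1 + z + of_nat n) - inverse (1 - z + of_nat n)
            = (- 2 * z) / ((1 + z + of_nat n) * (1 - z + of_nat n))"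
      using nz[of n] by (simp add: inverse_eq_divide diff_frac_eq)
    thus ?thesis unfolding e by simp
  qed
  thus ?thesis using * by simp
qed

subsection \<open>Reciprocity for cotangent series\<close>

text \<open>Serves twice: it supplies product majorants for the double series below, and it
  evaluates the separated terms of the reciprocity as products of zeta values. Unconditional
  summation over pairs makes the order of summation irrelevant.\<close>

lemma has_sum_product_nat:
  fixes f g :: "nat \<Rightarrow> complex"
  assumes "summable (\<lambda>n. norm (f n))" "summable (\<lambda>n. norm (g n))"
  shows "((\<lambda>(a,b). f a * g b) has_sum (suminf f * suminf g)) (UNIV \<times> UNIV)"
proof (rule has_sum_SigmaI)
  show "((\<lambda>b. case (a, b) of (a, b) \<Rightarrow> f a * g b) has_sum f a * suminf g) UNIV" for a
    using norm_summable_imp_has_sum[OF assms(2) summable_sums[OF summable_norm_cancel[OF assms(2)]]]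
    by (simp add: has_sum_cmult_right)
  show "((\<lambda>a. f a * suminf g) has_sum (suminf f * suminf g)) UNIV"
    using norm_summable_imp_has_sum[OF assms(1) summable_sums[OF summable_norm_cancel[OF assms(1)]]]
    by (simp add: has_sum_cmult_left)
  have "(\<lambda>(a,b). norm (f a) * norm (g b)) summable_on (UNIV \<times> UNIV)"
  proof (rule summable_on_SigmaI)
    show "((\<lambda>b. case (a, b) of (a, b) \<Rightarrow> norm (f a) * norm (g b)) has_sum
            norm (f a) * (\<Sum>n. norm (g n))) UNIV" for a
      using norm_summable_imp_has_sum[of "\<lambda>n. norm (g n)"] assms(2)
      by (auto intro!: has_sum_cmult_right simp: summable_sums)
    show "(\<lambda>a. norm (f a) * (\<Sum>n. norm (g n))) summable_on UNIV"
      using norm_summable_imp_summable_on[of "\<lambda>n. norm (f n)"] assms(1)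
      by (auto intro!: summable_on_cmult_left)
  qed auto
  hence "(\<lambda>p. norm (case p of (a,b) \<Rightarrow> f a * g b)) summable_on (UNIV \<times> UNIV)"
    by (simp add: case_prod_unfold norm_mult)
  thus "(\<lambda>(a,b). f a * g b) summable_on (UNIV \<times> UNIV)"
    by (rule abs_summable_summable)
qed

lemma summable_norm_inverse_power:
  assumes "m \<ge> 2"
  shows "summable (\<lambda>n. norm (1 / (of_nat (Suc n) :: complex) ^ m))"
proof -
  have "summable (\<lambda>n. inverse ((of_nat n :: real) ^ m))"
    by (rule inverse_power_summable) (use assms in auto)
  hence "summable (\<lambda>n. inverse ((of_nat (Suc n) :: real) ^ m))"
    by (subst summable_Suc_iff)
  thus ?thesis by (simp add: norm_divide norm_power field_simps del: of_nat_Suc)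
qed

text \<open>Ordinary powers replace \<open>powr\<close>; \<open>zeta_of_nat\<close> leads back to
  \<open>zeta\<close>.\<close>

definition zeta_nat :: "nat \<Rightarrow> complex" where
  "zeta_nat m = (\<Sum>n. 1 / of_nat (Suc n) ^ m)"

definition cot_series :: "nat \<Rightarrow> complex \<Rightarrow> complex" where
  "cot_series m \<tau> = (\<Sum>n. cot (of_real pi * (of_nat (Suc n) * \<tau>)) / of_nat (Suc n) ^ m)"

lemma zeta_nat_sums:
  "m \<ge> 2 \<Longrightarrow> (\<lambda>n. 1 / of_nat (Suc n) ^ m) sums zeta_nat m"
  unfolding zeta_nat_def
  by (rule summable_sums, rule summable_norm_cancel, rule summable_norm_inverse_power)

text \<open>Factor the form as \<open>(x * \<tau> + y) * (x * \<tau> - y)\<close>. Multiplying a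
  factor by \<open>cnj \<tau>\<close> makes its \<open>x\<close> part real, so its imaginary part
  depends only on \<open>y\<close>. The bound is therefore uniform in \<open>x\<close>; it gives
  both nonvanishing denominators and a majorant for the double series.\<close>

lemma norm_lattice_form_ge:
  fixes \<tau> :: complex and x y :: real
  assumes "\<tau> \<noteq> 0"
  shows "(Im \<tau> / norm \<tau>)\<^sup>2 * y\<^sup>2 \<le> norm ((of_real x)\<^sup>2 * \<tau>\<^sup>2 - (of_real y)\<^sup>2)"
proof -
  have *: "\<bar>y\<bar> * \<bar>Im \<tau>\<bar> / norm \<tau> \<le> norm (of_real x * \<tau> + of_real y)" for y :: real
  proof -
    have "\<bar>y\<bar> * \<bar>Im \<tau>\<bar> = \<bar>Im ((of_real x * \<tau> + of_real y) * cnj \<tau>)\<bar>"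
      by (simp add: abs_mult distrib_right)
    also have "\<dots> \<le> norm (of_real x * \<tau> + of_real y) * norm \<tau>"
      using abs_Im_le_cmod[of "(of_real x * \<tau> + of_real y) * cnj \<tau>"] by (simp only: norm_mult complex_mod_cnj)
    finally show ?thesis using assms by (simp add: pos_divide_le_eq)
  qed
  have "(Im \<tau> / norm \<tau>)\<^sup>2 * y\<^sup>2 = (\<bar>y\<bar> * \<bar>Im \<tau>\<bar> / norm \<tau>) * (\<bar>- y\<bar> * \<bar>Im \<tau>\<bar> / norm \<tau>)"
    by (simp add: power_divide power_mult_distrib flip: power2_eq_square)
  also have "\<dots> \<le> norm (of_real x * \<tau> + of_real y) * norm (of_real x * \<tau> + of_real (- y))"
    by (intro mult_mono *) auto
  also have "\<dots> = norm ((of_real x)\<^sup>2 * \<tau>\<^sup>2 - (of_real y)\<^sup>2)"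
    unfolding norm_mult[symmetric] by (simp add: power2_eq_square algebra_simps)
  finally show ?thesis .
qed

lemma of_nat_mult_notin_Ints:
  assumes "Im \<tau> \<noteq> 0" shows "of_nat (Suc n) * \<tau> \<notin> \<int>"
proof
  assume "of_nat (Suc n) * \<tau> \<in> \<int>"
  then obtain i where "of_nat (Suc n) * \<tau> = of_int i" by (elim Ints_cases)
  hence "Im (of_nat (Suc n) * \<tau>) = 0" by simp
  thus False using assms by (simp del: of_nat_Suc)
qed

text \<open>For fixed \<open>a\<close> the sum over \<open>b\<close> is the partial fraction series
  of the cotangent at \<open>Suc a * \<tau>\<close>. Summing over \<open>a\<close> then produces the
  cotangent series, and the polar terms \<open>1 / z\<close> produce
  \<open>zeta_nat (2 * r + 4)\<close>.\<close>

lemma cot_double_sum: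
  fixes \<tau> :: complex and r :: nat
  assumes "Im \<tau> \<noteq> 0"
  defines "T \<equiv> \<lambda>a b. 1 / (of_nat (Suc a) ^ (2 * r + 2) *
                        ((of_nat (Suc a))\<^sup>2 * \<tau>\<^sup>2 - (of_nat (Suc b))\<^sup>2))"
  shows "((\<lambda>(a,b). T a b) has_sum
           (of_real pi * cot_series (2 * r + 3) \<tau> - zeta_nat (2 * r + 4) / \<tau>) / (2 * \<tau>)) (UNIV \<times> UNIV)"
    and "summable (\<lambda>n. cot (of_real pi * (of_nat (Suc n) * \<tau>)) / of_nat (Suc n) ^ (2 * r + 3))"
proof -
  have "\<tau> \<noteq> 0" using assms by auto
  define c where "c = (Im \<tau> / norm \<tau>)\<^sup>2"
  have "c > 0" using assms(1) \<open>\<tau> \<noteq> 0\<close> by (simp add: c_def)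
  let ?f = "\<lambda>n. 1 / (of_nat (Suc n) :: complex) ^ (2 * r + 2)"
  let ?g = "\<lambda>n. 1 / (of_nat (Suc n) :: complex) ^ 2"
  have "(\<lambda>(a,b). ?f a * ?g b) summable_on (UNIV \<times> UNIV)"
    by (rule has_sum_imp_summable, rule has_sum_product_nat) (rule summable_norm_inverse_power, simp)+
  hence "(\<lambda>p. norm (case p of (a,b) \<Rightarrow> ?f a * ?g b)) summable_on (UNIV \<times> UNIV)"
    by (simp only: summable_on_iff_abs_summable_on_complex)
  \<comment> \<open>The lattice bound yields the majorant
    \<open>1 / (c * Suc a ^ (2 * r + 2) * Suc b ^ 2)\<close>, a product of two convergent
    series.\<close>
  hence "(\<lambda>p. norm (case p of (a,b) \<Rightarrow> ?f a * ?g b) * (1 / c)) summable_on (UNIV \<times> UNIV)"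
    by (rule summable_on_cmult_left)
  hence "(\<lambda>p. norm (case p of (a,b) \<Rightarrow> T a b)) summable_on (UNIV \<times> UNIV)"
  proof (rule summable_on_comparison_test)
    fix p :: "nat \<times> nat"
    obtain a b where p: "p = (a,b)" by force
    have "c * (real (Suc b))\<^sup>2 \<le> norm ((of_nat (Suc a))\<^sup>2 * \<tau>\<^sup>2 - (of_nat (Suc b))\<^sup>2)"
      using norm_lattice_form_ge[OF \<open>\<tau> \<noteq> 0\<close>, of "real (Suc b)" "real (Suc a)"]
      unfolding c_def of_real_of_nat_eq .
    moreover have pos: "0 < c * (real (Suc b))\<^sup>2"
      using \<open>c > 0\<close> by (simp del: of_nat_Suc)
    ultimately have norm_pos: "0 < norm ((of_nat (Suc a))\<^sup>2 * \<tau>\<^sup>2 - (of_nat (Suc b))\<^sup>2)"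
      and "real (Suc a) ^ (2 * r + 2) * (c * (real (Suc b))\<^sup>2)
            \<le> real (Suc a) ^ (2 * r + 2) * norm ((of_nat (Suc a))\<^sup>2 * \<tau>\<^sup>2 - (of_nat (Suc b))\<^sup>2)"
      by (linarith, intro mult_left_mono) auto
    hence "1 / (real (Suc a) ^ (2 * r + 2) * norm ((of_nat (Suc a))\<^sup>2 * \<tau>\<^sup>2 - (of_nat (Suc b))\<^sup>2))
            \<le> 1 / (real (Suc a) ^ (2 * r + 2) * (c * (real (Suc b))\<^sup>2))"
      by (intro divide_left_mono mult_pos_pos pos norm_pos) simp_all
    thus "norm (case p of (a,b) \<Rightarrow> T a b) \<le> norm (case p of (a,b) \<Rightarrow> ?f a * ?g b) * (1 / c)"
      unfolding p T_def prod.case norm_divide norm_mult norm_power norm_of_nat norm_one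
      by (simp add: mult_ac del: of_nat_Suc)
  qed auto
  hence summable: "(\<lambda>(a,b). T a b) summable_on (UNIV \<times> UNIV)"
    by (rule abs_summable_summable)
  then obtain S where S: "((\<lambda>(a,b). T a b) has_sum S) (UNIV \<times> UNIV)"
    by (auto simp: summable_on_def)
  define v where "v = (\<lambda>a. (of_real pi * cot (of_real pi * (of_nat (Suc a) * \<tau>)) - 1 / (of_nat (Suc a) * \<tau>))
                          * (1 / (2 * \<tau> * of_nat (Suc a) ^ (2 * r + 3))))"
  have v: "(T a has_sum v a) UNIV" for a
  proof -
    obtain w where w: "(T a has_sum w) UNIV"
      using summable_on_SigmaD1[OF summable, of a] by (auto simp: summable_on_def)
    have "T a = (\<lambda>n. 2 * (of_nat (Suc a) * \<tau>) / ((of_nat (Suc a) * \<tau>)\<^sup>2 - (of_nat (Suc n))\<^sup>2)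
                  * (1 / (2 * \<tau> * of_nat (Suc a) ^ (2 * r + 3))))"
    proof (intro ext)
      fix n
      define x D where "x = (of_nat (Suc a) :: complex)" and "D = x\<^sup>2 * \<tau>\<^sup>2 - (of_nat (Suc n))\<^sup>2"
      have "x \<noteq> 0" unfolding x_def by (simp del: of_nat_Suc)
      have e: "x ^ (2 * r + 3) = x * x ^ (2 * r + 2)" by (simp add: eval_nat_numeral)
      show "T a n = 2 * (of_nat (Suc a) * \<tau>) / ((of_nat (Suc a) * \<tau>)\<^sup>2 - (of_nat (Suc n))\<^sup>2)
                  * (1 / (2 * \<tau> * of_nat (Suc a) ^ (2 * r + 3)))"
        unfolding T_def power_mult_distrib x_def[symmetric] D_def[symmetric] e
        using \<open>\<tau> \<noteq> 0\<close> \<open>x \<noteq> 0\<close> by simp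
    qed
    also have "\<dots> sums v a"
      unfolding v_def by (intro sums_mult2 cot_partial_fractions of_nat_mult_notin_Ints assms)
    finally have "T a sums v a" .
    with has_sum_imp_sums[OF w] have "w = v a" using sums_unique2 by blast
    with w show ?thesis by simp
  qed
  have "(v has_sum S) UNIV"
    using has_sum_SigmaD[OF S, of v] v by simp
  hence vS: "v sums S" by (rule has_sum_imp_sums)
  \<comment> \<open>Solving the definition of \<open>v n\<close> for its cotangent term writes the
    cotangent series as a combination of two convergent series, so its convergence is a
    by-product.\<close>
  have "(\<lambda>n. (2 * \<tau> * v n + 1 / \<tau> * (1 / of_nat (Suc n) ^ (2 * r + 4))) / of_real pi)
          sums ((2 * \<tau> * S + 1 / \<tau> * zeta_nat (2 * r + 4)) / of_real pi)"
    by (intro sums_divide sums_add sums_mult vS zeta_nat_sums) simp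
  moreover have "(2 * \<tau> * v n + 1 / \<tau> * (1 / of_nat (Suc n) ^ (2 * r + 4))) / of_real pi
       = cot (of_real pi * (of_nat (Suc n) * \<tau>)) / of_nat (Suc n) ^ (2 * r + 3)" for n
  proof -
    define x where "x = (of_nat (Suc n) :: complex)"
    have "x \<noteq> 0" unfolding x_def by (simp del: of_nat_Suc)
    have e: "x ^ (2 * r + 4) = x * x ^ (2 * r + 3)" by (simp add: eval_nat_numeral)
    define y where "y = x ^ (2 * r + 3)"
    have "y \<noteq> 0" using \<open>x \<noteq> 0\<close> by (simp add: y_def)
    show ?thesis
      unfolding v_def x_def[symmetric] e y_def[symmetric]
      using \<open>\<tau> \<noteq> 0\<close> \<open>x \<noteq> 0\<close> \<open>y \<noteq> 0\<close> by (simp add: field_simps)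
  qed
  ultimately have C: "(\<lambda>n. cot (of_real pi * (of_nat (Suc n) * \<tau>)) / of_nat (Suc n) ^ (2 * r + 3))
          sums ((2 * \<tau> * S + 1 / \<tau> * zeta_nat (2 * r + 4)) / of_real pi)"
    by simp
  thus "summable (\<lambda>n. cot (of_real pi * (of_nat (Suc n) * \<tau>)) / of_nat (Suc n) ^ (2 * r + 3))"
    by (simp add: sums_iff)
  have "cot_series (2 * r + 3) \<tau> = (2 * \<tau> * S + 1 / \<tau> * zeta_nat (2 * r + 4)) / of_real pi"
    using C unfolding cot_series_def by (simp add: sums_iff)
  hence "S = (of_real pi * cot_series (2 * r + 3) \<tau> - zeta_nat (2 * r + 4) / \<tau>) / (2 * \<tau>)"
    using \<open>\<tau> \<noteq> 0\<close> by simp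
  with S show "((\<lambda>(a,b). T a b) has_sum
           (of_real pi * cot_series (2 * r + 3) \<tau> - zeta_nat (2 * r + 4) / \<tau>) / (2 * \<tau>)) (UNIV \<times> UNIV)"
    by simp
qed

text \<open>Oddness of the cotangent. It replaces \<open>1 / \<tau>\<close> in the reciprocity by
  \<open>- 1 / \<tau>\<close>, which remains in the upper half-plane, where the Lambert series
  converges.\<close>

lemma cot_series_minus:
  assumes "Im \<tau> \<noteq> 0"
  shows "cot_series (2 * r + 3) (- \<tau>) = - cot_series (2 * r + 3) \<tau>"
proof -
  have "cot (- w) = - cot w" for w :: complex by (simp add: cot_def)
  thus ?thesis unfolding cot_series_def mult_minus_right minus_divide_left[symmetric]
    using suminf_minus[OF cot_double_sum(2)[OF assms, of r]] by simp
qed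

lemma has_sum_finite_sum:
  fixes f :: "'i \<Rightarrow> 'a \<Rightarrow> 'b :: topological_comm_monoid_add"
  assumes "\<And>i. i \<in> I \<Longrightarrow> (f i has_sum S i) A"
  shows "((\<lambda>x. \<Sum>i\<in>I. f i x) has_sum (\<Sum>i\<in>I. S i)) A"
  using assms by (induction I rule: infinite_finite_induct) (auto intro: has_sum_add)

text \<open>In the double sum at \<open>1 / \<tau>\<close> exchange the two indices. Its
  denominators then agree with those at \<open>\<tau>\<close> up to a factor, and the weight
  \<open>\<tau> ^ (2 * r)\<close> turns the sum of two corresponding terms into a difference of
  \<open>Suc r\<close>-th powers over that denominator. The denominator cancels, and the remaining
  finite geometric sum separates the indices.\<close>

lemma cot_series_reciprocity_zeta:
  fixes \<tau> :: complex
  assumes "Im \<tau> \<noteq> 0"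
  shows "of_real pi * (cot_series (2 * r + 3) \<tau> + \<tau> ^ (2 * r + 2) * cot_series (2 * r + 3) (1 / \<tau>))
          = zeta_nat (2 * r + 4) * (1 / \<tau> + \<tau> ^ (2 * r + 3))
            - 2 * \<tau> * (\<Sum>i<Suc r. zeta_nat (2 * i + 2) * zeta_nat (2 * (r - i) + 2) * \<tau> ^ (2 * (r - i)))"
proof -
  have "\<tau> \<noteq> 0" using assms by auto
  have Im': "Im (1 / \<tau>) \<noteq> 0" using assms by (auto simp: Im_divide complex_eq_iff)
  define R where "R = (\<Sum>i<Suc r. zeta_nat (2 * i + 2) * zeta_nat (2 * (r - i) + 2) * \<tau> ^ (2 * (r - i)))"
  define S where "S = (\<lambda>\<tau>. (of_real pi * cot_series (2 * r + 3) \<tau> - zeta_nat (2 * r + 4) / \<tau>) / (2 * \<tau>))"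
  define D where "D = (\<lambda>a b. (of_nat (Suc a))\<^sup>2 * \<tau>\<^sup>2 - (of_nat (Suc b) :: complex)\<^sup>2)"
  have Dnz: "D a b \<noteq> 0" for a b
  proof -
    have "(Im \<tau> / norm \<tau>)\<^sup>2 * (real (Suc b))\<^sup>2 > 0"
      using assms \<open>\<tau> \<noteq> 0\<close> by (simp del: of_nat_Suc)
    with norm_lattice_form_ge[OF \<open>\<tau> \<noteq> 0\<close>, of "real (Suc b)" "real (Suc a)"] show ?thesis
      unfolding D_def of_real_of_nat_eq by auto
  qed
  have 1: "((\<lambda>(a,b). 1 / (of_nat (Suc a) ^ (2 * r + 2) * D a b)) has_sum S \<tau>) (UNIV \<times> UNIV)"
    unfolding S_def D_def by (rule cot_double_sum) fact
  have 2: "((\<lambda>(a,b). \<tau> ^ (2 * r) * (1 / (of_nat (Suc b) ^ (2 * r + 2) * ((of_nat (Suc b))\<^sup>2 * (1 / \<tau>)\<^sup>2 - (of_nat (Suc a))\<^sup>2))))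
          has_sum (\<tau> ^ (2 * r) * S (1 / \<tau>))) (UNIV \<times> UNIV)"
    using has_sum_cmult_right[OF iffD1[OF has_sum_swap cot_double_sum(1)[OF Im', of r]], of "\<tau> ^ (2 * r)"]
    unfolding S_def by (simp add: case_prod_unfold)
  have eq: "1 / (of_nat (Suc a) ^ (2 * r + 2) * D a b) +
          \<tau> ^ (2 * r) * (1 / (of_nat (Suc b) ^ (2 * r + 2) * ((of_nat (Suc b))\<^sup>2 * (1 / \<tau>)\<^sup>2 - (of_nat (Suc a))\<^sup>2)))
        = (\<Sum>i<Suc r. - (\<tau> ^ (2 * (r - i))) * (1 / of_nat (Suc a) ^ (2 * i + 2) * (1 / of_nat (Suc b) ^ (2 * (r - i) + 2))))"
    for a b
  proof -
    define n k :: complex where "n = of_nat (Suc a)" and "k = of_nat (Suc b)"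
    have nz: "n \<noteq> 0" "k \<noteq> 0" unfolding n_def k_def by (simp_all del: of_nat_Suc)
    define d where "d = n\<^sup>2 * \<tau>\<^sup>2 - k\<^sup>2"
    have dnz: "d \<noteq> 0" using Dnz[of a b] by (simp add: d_def D_def n_def k_def)
    \<comment> \<open>Chosen so that the two terms are \<open>x ^ Suc r / d\<close> and
      \<open>- y ^ Suc r / d\<close>, while \<open>x - y\<close> is itself a multiple of
      \<open>d\<close>.\<close>
    define x y where "x = 1 / n\<^sup>2" and "y = \<tau>\<^sup>2 / k\<^sup>2"
    have xy: "x - y = - d / (n\<^sup>2 * k\<^sup>2)"
      using nz by (simp add: x_def y_def d_def field_simps)
    have d': "k\<^sup>2 * (1 / \<tau>)\<^sup>2 - n\<^sup>2 = - d / \<tau>\<^sup>2"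
      using \<open>\<tau> \<noteq> 0\<close> by (simp add: d_def field_simps)
    have x': "x ^ Suc r = 1 / n ^ (2 * r + 2)"
      unfolding x_def power_divide power_mult[symmetric] by simp
    have y': "y ^ Suc r = \<tau> ^ (2 * r) * \<tau>\<^sup>2 / k ^ (2 * r + 2)"
      unfolding y_def power_divide power_mult[symmetric] power_add[symmetric] by simp
    have "1 / (n ^ (2 * r + 2) * d) + \<tau> ^ (2 * r) * (1 / (k ^ (2 * r + 2) * (- d / \<tau>\<^sup>2)))
        = (x ^ Suc r - y ^ Suc r) / d"
      unfolding x' y' by (simp add: diff_divide_distrib)
    also have "x ^ Suc r - y ^ Suc r = (x - y) * (\<Sum>i<Suc r. x ^ i * y ^ (r - i))"
      by (rule diff_power_eq_sum)
    also have "\<dots> / d = - (1 / (n\<^sup>2 * k\<^sup>2)) * (\<Sum>i<Suc r. x ^ i * y ^ (r - i))"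
      unfolding xy using dnz by simp
    also have "\<dots> = (\<Sum>i<Suc r. - (\<tau> ^ (2 * (r - i))) * (1 / n ^ (2 * i + 2) * (1 / k ^ (2 * (r - i) + 2))))"
      unfolding sum_distrib_left x_def y_def power_divide power_add power_mult[symmetric] power_one
      by (intro sum.cong refl) (simp add: power2_eq_square)
    finally show ?thesis unfolding n_def[symmetric] k_def[symmetric] D_def d'
      unfolding d_def[symmetric] .
  qed
  have "((\<lambda>p. \<Sum>i<Suc r. case p of (a,b) \<Rightarrow> - (\<tau> ^ (2 * (r - i))) *
              (1 / of_nat (Suc a) ^ (2 * i + 2) * (1 / of_nat (Suc b) ^ (2 * (r - i) + 2))))
         has_sum (\<Sum>i<Suc r. - (\<tau> ^ (2 * (r - i))) * (zeta_nat (2 * i + 2) * zeta_nat (2 * (r - i) + 2)))) (UNIV \<times> UNIV)"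
  proof (rule has_sum_finite_sum)
    fix i assume "i \<in> {..<Suc r}"
    show "((\<lambda>p. case p of (a,b) \<Rightarrow> - (\<tau> ^ (2 * (r - i))) *
              (1 / of_nat (Suc a) ^ (2 * i + 2) * (1 / of_nat (Suc b) ^ (2 * (r - i) + 2))))
         has_sum (- (\<tau> ^ (2 * (r - i))) * (zeta_nat (2 * i + 2) * zeta_nat (2 * (r - i) + 2)))) (UNIV \<times> UNIV)"
      using has_sum_cmult_right[OF has_sum_product_nat[OF summable_norm_inverse_power[of "2 * i + 2"]
              summable_norm_inverse_power[of "2 * (r - i) + 2"]], of "- (\<tau> ^ (2 * (r - i)))"]
      unfolding zeta_nat_def by (simp add: case_prod_unfold)
  qed
  moreover have "((\<lambda>p. \<Sum>i<Suc r. case p of (a,b) \<Rightarrow> - (\<tau> ^ (2 * (r - i))) *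
              (1 / of_nat (Suc a) ^ (2 * i + 2) * (1 / of_nat (Suc b) ^ (2 * (r - i) + 2))))
         has_sum (S \<tau> + \<tau> ^ (2 * r) * S (1 / \<tau>))) (UNIV \<times> UNIV)"
    using has_sum_add[OF 1 2] unfolding case_prod_unfold eq .
  ultimately have "S \<tau> + \<tau> ^ (2 * r) * S (1 / \<tau>) =
      (\<Sum>i<Suc r. - (\<tau> ^ (2 * (r - i))) * (zeta_nat (2 * i + 2) * zeta_nat (2 * (r - i) + 2)))"
    using has_sum_unique by blast
  also have "\<dots> = - R"
    unfolding sum_negf[symmetric] R_def by (intro sum.cong) auto
  finally have "2 * \<tau> * (S \<tau> + \<tau> ^ (2 * r) * S (1 / \<tau>)) = - 2 * \<tau> * R"
    by simp
  moreover have "2 * \<tau> * (S \<tau> + \<tau> ^ (2 * r) * S (1 / \<tau>)) =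
     of_real pi * (cot_series (2 * r + 3) \<tau> + \<tau> ^ (2 * r + 2) * cot_series (2 * r + 3) (1 / \<tau>))
       - zeta_nat (2 * r + 4) * (1 / \<tau> + \<tau> ^ (2 * r + 3))"
  proof -
    have "\<tau> ^ (2 * r + 2) = \<tau> ^ (2 * r) * \<tau>\<^sup>2" "\<tau> ^ (2 * r + 3) = \<tau> ^ (2 * r) * \<tau> ^ 3"
      by (simp_all only: power_add)
    thus ?thesis unfolding S_def using \<open>\<tau> \<noteq> 0\<close>
      by (simp add: field_simps power2_eq_square power3_eq_cube)
  qed
  ultimately show ?thesis unfolding R_def[symmetric] by (simp add: algebra_simps)
qed

subsection \<open>Zeta values at even integers\<close>

lemma cot_conv_exp:
  fixes w :: complex
  assumes "sin w \<noteq> 0"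
  shows "exp (2 * \<i> * w) \<noteq> 1"
    and "cot w = \<i> * (exp (2 * \<i> * w) + 1) / (exp (2 * \<i> * w) - 1)"
proof -
  define E where "E = exp (\<i> * w)"
  have "E \<noteq> 0" by (simp add: E_def)
  have E2: "exp (2 * \<i> * w) = E * E" by (simp add: E_def mult.assoc flip: exp_add)
  have inv: "exp (- (\<i> * w)) = inverse E" by (simp add: E_def exp_minus)
  have s: "sin w = (E - inverse E) / (2 * \<i>)" and c: "cos w = (E + inverse E) / 2"
    unfolding sin_exp_eq cos_exp_eq by (simp_all add: inv E_def[symmetric])
  show "exp (2 * \<i> * w) \<noteq> 1"
    using assms \<open>E \<noteq> 0\<close> unfolding s E2 by (auto simp: field_simps)
  moreover have "E - inverse E = (E * E - 1) / E" "E + inverse E = (E * E + 1) / E"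
    using \<open>E \<noteq> 0\<close> by (simp_all add: field_simps)
  ultimately show "cot w = \<i> * (exp (2 * \<i> * w) + 1) / (exp (2 * \<i> * w) - 1)"
    using \<open>E \<noteq> 0\<close> unfolding cot_def s c E2 by (simp add: field_simps)
qed

lemma sin_pi_times_nonzero: "(z :: complex) \<notin> \<int> \<Longrightarrow> sin (of_real pi * z) \<noteq> 0"
  by (auto simp: sin_eq_0)

lemma small_notin_Ints:
  fixes z :: complex
  assumes "z \<noteq> 0" "norm z < 1"
  shows "z \<notin> \<int>"
proof
  assume "z \<in> \<int>"
  then obtain i where "z = of_int i" by (elim Ints_cases)
  thus False using assms by auto
qed

text \<open>Sum the same double family in two orders. For fixed \<open>a\<close> the sum over
  \<open>b\<close> is a zeta value; for fixed \<open>b\<close> the sum over \<open>a\<close> is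
  geometric with ratio \<open>z\<^sup>2 / (Suc b)\<^sup>2\<close> and gives one partial fraction of
  the cotangent.\<close>

lemma zeta_nat_even_generating_function:
  fixes z :: complex
  assumes "z \<noteq> 0" "norm z < 1"
  shows "(\<lambda>j. zeta_nat (2 * j + 2) * z ^ (2 * j + 2)) sums ((1 - of_real pi * z * cot (of_real pi * z)) / 2)"
proof -
  define G where "G = (\<lambda>a b. z ^ (2 * a + 2) * (1 / of_nat (Suc b) ^ (2 * a + 2)))"
  have z2: "norm (z\<^sup>2) < 1" using assms by (simp add: norm_power power_less_one_iff abs_square_less_1)
  have sg: "summable (\<lambda>a. norm (z ^ (2 * a + 2)))"
  proof -
    have "summable (\<lambda>a. ((norm z)\<^sup>2) ^ a * (norm z)\<^sup>2)"
      using z2 by (intro summable_mult2 summable_geometric) (simp add: norm_power)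
    also have "(\<lambda>a. ((norm z)\<^sup>2) ^ a * (norm z)\<^sup>2) = (\<lambda>a. norm (z ^ (2 * a + 2)))"
      by (simp only: norm_mult norm_power power_add power_mult)
    finally show ?thesis .
  qed
  \<comment> \<open>Lowering the exponent of \<open>Suc b\<close> from \<open>2 * a + 2\<close> to 2
    gives a majorant that factors.\<close>
  have "(\<lambda>(a,b). z ^ (2 * a + 2) * (1 / (of_nat (Suc b)) ^ 2)) summable_on (UNIV \<times> UNIV)"
    by (rule has_sum_imp_summable, rule has_sum_product_nat) (rule sg, rule summable_norm_inverse_power, simp)
  hence "(\<lambda>p. norm (case p of (a,b) \<Rightarrow> z ^ (2 * a + 2) * (1 / (of_nat (Suc b)) ^ 2))) summable_on (UNIV \<times> UNIV)"
    by (simp only: summable_on_iff_abs_summable_on_complex)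
  hence "(\<lambda>p. norm (case p of (a,b) \<Rightarrow> G a b)) summable_on (UNIV \<times> UNIV)"
  proof (rule summable_on_comparison_test)
    fix p :: "nat \<times> nat"
    obtain a b where p: "p = (a,b)" by force
    have "1 / real (Suc b) ^ (2 * a + 2) \<le> 1 / real (Suc b) ^ 2"
      by (intro divide_left_mono power_increasing mult_pos_pos zero_less_power) simp_all
    thus "norm (case p of (a,b) \<Rightarrow> G a b)
            \<le> norm (case p of (a,b) \<Rightarrow> z ^ (2 * a + 2) * (1 / (of_nat (Suc b)) ^ 2))"
      unfolding p G_def prod.case norm_mult norm_divide norm_power norm_of_nat norm_one
      by (intro mult_left_mono) simp_all
  qed simp
  hence "(\<lambda>(a,b). G a b) summable_on (UNIV \<times> UNIV)"
    by (rule abs_summable_summable)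
  then obtain S where S: "((\<lambda>(a,b). G a b) has_sum S) (UNIV \<times> UNIV)"
    by (auto simp: summable_on_def)
  have "((\<lambda>b. G a b) has_sum (z ^ (2 * a + 2) * zeta_nat (2 * a + 2))) UNIV" for a
    unfolding G_def
    by (intro has_sum_cmult_right norm_summable_imp_has_sum summable_norm_inverse_power zeta_nat_sums) simp_all
  with S have "((\<lambda>a. z ^ (2 * a + 2) * zeta_nat (2 * a + 2)) has_sum S) UNIV"
    by (intro has_sum_SigmaD[OF S]) simp
  hence 1: "(\<lambda>a. zeta_nat (2 * a + 2) * z ^ (2 * a + 2)) sums S"
    using has_sum_imp_sums by (simp add: mult.commute)

  have "((\<lambda>a. G a b) has_sum ((- z / 2) * (2 * z / (z\<^sup>2 - (of_nat (Suc b))\<^sup>2)))) UNIV" for b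
  proof -
    define k where "k = (of_nat (Suc b) :: complex)"
    have "k \<noteq> 0" unfolding k_def by (simp del: of_nat_Suc)
    have "1 \<le> norm k" unfolding k_def norm_of_nat by simp
    hence k2: "1 \<le> norm (k\<^sup>2)" by (simp add: norm_power)
    define w where "w = z\<^sup>2 / k\<^sup>2"
    have "norm w < 1"
      using z2 k2 by (simp add: w_def norm_divide divide_less_eq)
    have sw: "summable (\<lambda>a. norm (w * w ^ a))"
      using \<open>norm w < 1\<close> by (simp add: norm_mult norm_power summable_mult summable_geometric)
    have "(\<lambda>a. w * w ^ a) sums (w * (1 / (1 - w)))"
      using \<open>norm w < 1\<close> by (intro sums_mult geometric_sums)
    with sw have "((\<lambda>a. w * w ^ a) has_sum (w * (1 / (1 - w)))) UNIV"
      by (rule norm_summable_imp_has_sum)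
    moreover have "(\<lambda>a. w * w ^ a) = (\<lambda>a. G a b)"
      unfolding G_def k_def[symmetric] w_def
      by (intro ext) (simp add: power_divide power_mult power_add power2_eq_square mult.assoc)
    moreover have "w * (1 / (1 - w)) = (- z / 2) * (2 * z / (z\<^sup>2 - k\<^sup>2))"
    proof -
      have "1 - w = (k\<^sup>2 - z\<^sup>2) / k\<^sup>2" using \<open>k \<noteq> 0\<close> by (simp add: w_def diff_divide_distrib)
      hence "w * (1 / (1 - w)) = z\<^sup>2 / (k\<^sup>2 - z\<^sup>2)"
        using \<open>k \<noteq> 0\<close> by (simp add: w_def)
      also have "\<dots> = - (z\<^sup>2 / (z\<^sup>2 - k\<^sup>2))"
        by (metis minus_diff_eq minus_divide_right)
      finally show ?thesis by (simp add: power2_eq_square)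
    qed
    ultimately show ?thesis by (simp add: k_def)
  qed
  with iffD1[OF has_sum_swap S]
  have "((\<lambda>b. (- z / 2) * (2 * z / (z\<^sup>2 - (of_nat (Suc b))\<^sup>2))) has_sum S) UNIV"
    by (intro has_sum_SigmaD[OF iffD1[OF has_sum_swap S]]) simp
  hence "(\<lambda>b. (- z / 2) * (2 * z / (z\<^sup>2 - (of_nat (Suc b))\<^sup>2))) sums S"
    by (rule has_sum_imp_sums)
  moreover have "(\<lambda>b. (- z / 2) * (2 * z / (z\<^sup>2 - (of_nat (Suc b))\<^sup>2)))
                   sums ((- z / 2) * (of_real pi * cot (of_real pi * z) - 1 / z))"
    by (intro sums_mult cot_partial_fractions small_notin_Ints assms)
  ultimately have "S = (- z / 2) * (of_real pi * cot (of_real pi * z) - 1 / z)"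
    using sums_unique2 by blast
  also have "\<dots> = (1 - of_real pi * z * cot (of_real pi * z)) / 2"
    using assms by (simp add: field_simps)
  finally show ?thesis using 1 by (simp only:)
qed

section \<open>Euler's formula: from the generating function to Bernoulli numbers\<close>

lemma bernoulli_egf_complex:
  "Abs_fps (\<lambda>n. of_real (bernoulli n / fact n)) * (fps_exp 1 - 1) = (fps_X :: complex fps)"
proof (rule fps_ext)
  fix n
  have "fps_nth (Abs_fps (\<lambda>n. of_real (bernoulli n / fact n)) * (fps_exp 1 - 1) :: complex fps) n
      = of_real (fps_nth (Abs_fps (\<lambda>n. bernoulli n / fact n) * (fps_exp 1 - 1)) n)"
    unfolding fps_mult_nth of_real_sum by (intro sum.cong refl) simp
  also have "\<dots> = fps_nth fps_X n"
    unfolding bernoulli_egf by (simp add: fps_X_def)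
  finally show "fps_nth (Abs_fps (\<lambda>n. of_real (bernoulli n / fact n)) * (fps_exp 1 - 1) :: complex fps) n
      = fps_nth fps_X n" .
qed

text \<open>The value of \<open>bernoulli n / fact n\<close> predicted by Euler's formula. Starting
  from zeta values makes the power series summable by the cotangent;
  \<open>bernoulli_coeff_eq\<close> confirms the prediction afterwards.\<close>

definition bernoulli_coeff :: "nat \<Rightarrow> complex" where
  "bernoulli_coeff n = (if n = 0 then 1 else if n = 1 then - 1 / 2 else
     if even n then - 2 * zeta_nat n / (2 * of_real pi * \<i>) ^ n else 0)"

text \<open>With \<open>t = 2 * pi * \<i> * z\<close>, the product of \<open>pi * z\<close> and
  \<open>cot (pi * z)\<close> is \<open>t / (exp t - 1) + t / 2\<close>, so the generating function
  of the even zeta values supplies every coefficient from index 2 on.\<close>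

lemma bernoulli_coeff_sums:
  fixes t :: complex
  assumes "t \<noteq> 0" "norm t < 2 * pi"
  shows "(\<lambda>n. bernoulli_coeff n * t ^ n) sums (t / (exp t - 1))"
    and "exp t \<noteq> 1"
proof -
  define z where "z = t / (2 * of_real pi * \<i>)"
  have t: "t = 2 * \<i> * (of_real pi * z)" by (simp add: z_def)
  have z: "z \<noteq> 0" "norm z < 1" using assms by (auto simp: z_def norm_divide norm_mult)
  have sin: "sin (of_real pi * z) \<noteq> 0"
    by (intro sin_pi_times_nonzero small_notin_Ints z)
  show "exp t \<noteq> 1" unfolding t by (rule cot_conv_exp[OF sin])
  have "(\<lambda>j. - 2 * (zeta_nat (2 * j + 2) * z ^ (2 * j + 2))) sums
         (- 2 * ((1 - of_real pi * z * cot (of_real pi * z)) / 2))"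
    by (intro sums_mult zeta_nat_even_generating_function z)
  also have "(\<lambda>j. - 2 * (zeta_nat (2 * j + 2) * z ^ (2 * j + 2)))
           = (\<lambda>j. bernoulli_coeff (2 * j + 2) * t ^ (2 * j + 2))"
    by (intro ext) (simp add: bernoulli_coeff_def z_def power_divide)
  \<comment> \<open>The condition always holds; it presents the terms as a family composed with
    \<open>j \<mapsto> 2 * j\<close>, so that reindexing can insert zeros at the odd
    indices.\<close>
  finally have "(\<lambda>j. if even (2 * j) then bernoulli_coeff (2 * j + 2) * t ^ (2 * j + 2) else 0) sums
         (- (1 - of_real pi * z * cot (of_real pi * z)))" by (simp add: diff_divide_distrib)
  also have "?this \<longleftrightarrow> (\<lambda>n. if even n then bernoulli_coeff (n + 2) * t ^ (n + 2) else 0) sums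
         (- (1 - of_real pi * z * cot (of_real pi * z)))"
    by (rule sums_mono_reindex[where g = "\<lambda>j. 2 * j"]) (auto simp: strict_mono_def elim!: evenE)
  also have "(\<lambda>n. if even n then bernoulli_coeff (n + 2) * t ^ (n + 2) else 0)
           = (\<lambda>n. bernoulli_coeff (n + 2) * t ^ (n + 2))"
    by (auto simp: bernoulli_coeff_def)
  \<comment> \<open>Undoing the shift by 2 restores the two initial terms
    \<open>1 - t / 2\<close>.\<close>
  finally have "(\<lambda>n. bernoulli_coeff n * t ^ n) sums
     (- (1 - of_real pi * z * cot (of_real pi * z)) + (\<Sum>n<2. bernoulli_coeff n * t ^ n))"
    by (subst (asm) sums_iff_shift)
  also have "(\<Sum>n<2. bernoulli_coeff n * t ^ n) = 1 - t / 2"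
    by (simp add: eval_nat_numeral bernoulli_coeff_def)
  also have "- (1 - of_real pi * z * cot (of_real pi * z)) + (1 - t / 2)
           = of_real pi * z * (\<i> * (exp t + 1) / (exp t - 1)) - t / 2"
    using cot_conv_exp(2)[OF sin] unfolding t[symmetric] by simp
  also have "of_real pi * z = t / (2 * \<i>)" by (simp add: z_def)
  also have "t / (2 * \<i>) * (\<i> * (exp t + 1) / (exp t - 1)) - t / 2 = t / (exp t - 1)"
    using \<open>exp t \<noteq> 1\<close> by (simp add: divide_simps) (simp add: algebra_simps)
  finally show "(\<lambda>n. bernoulli_coeff n * t ^ n) sums (t / (exp t - 1))" .
qed

text \<open>Both coefficient sequences, multiplied by the series of \<open>exp t - 1\<close>, give
  \<open>t\<close>: one by the convergent expansion near 0, the other by the formal identity. Formal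
  power series over a field have no zero divisors, so the common factor cancels.\<close>

lemma bernoulli_coeff_eq: "bernoulli_coeff n = of_real (bernoulli n / fact n)"
proof -
  \<comment> \<open>The value 1 at 0 fills the removable singularity and matches
    \<open>bernoulli_coeff 0\<close>.\<close>
  define h where "h = (\<lambda>t::complex. if t = 0 then 1 else t / (exp t - 1))"
  have near: "eventually (\<lambda>t::complex. t \<in> ball 0 (2 * pi)) (nhds 0)"
    by (intro eventually_nhds_in_open) auto
  have "h has_fps_expansion Abs_fps bernoulli_coeff"
  proof (rule has_fps_expansionI, use near in eventually_elim)
    case (elim t)
    show ?case
    proof (cases "t = 0")
      case True
      have "(\<lambda>n. bernoulli_coeff n * 0 ^ n) sums bernoulli_coeff 0"
        by (rule powser_sums_zero)
      thus ?thesis using True by (simp add: h_def bernoulli_coeff_def)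
    next
      case False
      thus ?thesis using bernoulli_coeff_sums(1)[of t] elim by (simp add: h_def)
    qed
  qed
  hence "(\<lambda>t. h t * (exp t - 1)) has_fps_expansion (Abs_fps bernoulli_coeff * (fps_exp 1 - 1))"
    by (intro has_fps_expansion_mult has_fps_expansion_diff has_fps_expansion_exp1 has_fps_expansion_1)
  hence "fps_conv_radius (Abs_fps bernoulli_coeff * (fps_exp 1 - 1)) > 0"
    and ev: "eventually (\<lambda>t. eval_fps (Abs_fps bernoulli_coeff * (fps_exp 1 - 1)) t = h t * (exp t - 1)) (nhds 0)"
    by (auto simp: has_fps_expansion_def)
  moreover have "eventually (\<lambda>t. eval_fps (Abs_fps bernoulli_coeff * (fps_exp 1 - 1)) t = t) (nhds 0)"
    using ev near
  proof eventually_elim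
    case (elim t)
    thus ?case using bernoulli_coeff_sums(2)[of t] by (auto simp: h_def)
  qed
  ultimately have "(\<lambda>t. t) has_fps_expansion (Abs_fps bernoulli_coeff * (fps_exp 1 - 1))"
    by (simp add: has_fps_expansion_def)
  note fps_nth_fps_expansion[OF this]
  hence "Abs_fps bernoulli_coeff * (fps_exp 1 - 1) = fps_X"
    by (intro fps_ext) (simp only: fps_nth_fps_expansion[OF has_fps_expansion_fps_X])
  also have "\<dots> = Abs_fps (\<lambda>n. of_real (bernoulli n / fact n)) * (fps_exp 1 - 1)"
    by (rule bernoulli_egf_complex[symmetric])
  finally have "Abs_fps bernoulli_coeff = Abs_fps (\<lambda>n. of_real (bernoulli n / fact n))"
  proof (subst (asm) mult_right_cancel)
    have "fps_nth (fps_exp 1 - 1 :: complex fps) 1 \<noteq> 0" by simp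
    thus "fps_exp 1 - 1 \<noteq> (0 :: complex fps)" by (metis fps_zero_nth)
  qed
  thus ?thesis by (simp add: fps_eq_iff)
qed

text \<open>At \<open>j = 0\<close> this is \<open>- 1 / 2\<close>, the value of the analytic continuation, which \<open>zeta_nat\<close> does not have.\<close>
definition zeta_even :: "nat \<Rightarrow> complex" where
  "zeta_even j = of_real ((-1) ^ (j + 1) * (2 * pi) ^ (2 * j) * bernoulli (2 * j) / (2 * fact (2 * j)))"

lemma zeta_even_0: "zeta_even 0 = - 1 / 2"
  using bernoulli_coeff_eq[of 0] by (simp add: zeta_even_def bernoulli_coeff_def flip: of_real_eq_1_iff)

lemma zeta_nat_even:
  assumes "j > 0"
  shows "zeta_nat (2 * j) = zeta_even j"
proof -
  have "(2 * of_real pi * \<i>) ^ (2 * j) = of_real ((2 * pi) ^ (2 * j) * (-1) ^ j)"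
  proof -
    have "(2 * of_real pi * \<i>)\<^sup>2 = of_real (- ((2 * pi)\<^sup>2))"
      by (simp add: power_mult_distrib)
    hence "(2 * of_real pi * \<i>) ^ (2 * j) = of_real ((- ((2 * pi)\<^sup>2)) ^ j)"
      by (simp only: power_mult of_real_power)
    also have "(- ((2 * pi)\<^sup>2)) ^ j = (2 * pi) ^ (2 * j) * (-1) ^ j"
      unfolding power_minus[of "(2 * pi)\<^sup>2"] power_mult by simp
    finally show ?thesis .
  qed
  hence eq: "(- 2) * zeta_nat (2 * j) = bernoulli_coeff (2 * j) * of_real ((2 * pi) ^ (2 * j) * (-1) ^ j)"
    using assms by (simp add: bernoulli_coeff_def)
  have "zeta_nat (2 * j) = (- 2) * zeta_nat (2 * j) / (- 2)" by simp
  also have "\<dots> = zeta_even j" unfolding eq bernoulli_coeff_eq zeta_even_def by (simp add: mult_ac)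
  finally show ?thesis .
qed

text \<open>Since \<open>zeta_even 0\<close> is \<open>- 1 / 2\<close>, the boundary indices
  \<open>0\<close> and \<open>r + 2\<close> account exactly for the two terms with
  \<open>zeta_nat (2 * r + 4)\<close>, and the right-hand side becomes one symmetric sum.\<close>

lemma cot_series_reciprocity:
  fixes \<tau> :: complex
  assumes "Im \<tau> \<noteq> 0"
  shows "of_real pi * (cot_series (2 * r + 3) \<tau> + \<tau> ^ (2 * r + 2) * cot_series (2 * r + 3) (1 / \<tau>))
          = - (2 / \<tau>) * (\<Sum>j\<le>r + 2. zeta_even j * zeta_even (r + 2 - j) * \<tau> ^ (2 * j))"
proof -
  have "\<tau> \<noteq> 0" using assms by auto
  let ?f = "\<lambda>j. zeta_even j * zeta_even (r + 2 - j) * \<tau> ^ (2 * j)"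
  have e: "zeta_nat (2 * i + 2) = zeta_even (Suc i)" for i
    using zeta_nat_even[of "Suc i"] by simp
  \<comment> \<open>Reversing the sum makes the exponent of \<open>\<tau>\<close> grow with the
    index; the division by \<open>\<tau>\<^sup>2\<close> compensates for the shift from
    \<open>i\<close> to \<open>Suc i\<close>.\<close>
  have "(\<Sum>i<Suc r. zeta_nat (2 * i + 2) * zeta_nat (2 * (r - i) + 2) * \<tau> ^ (2 * (r - i)))
      = (\<Sum>i<Suc r. zeta_nat (2 * (Suc r - Suc i) + 2) * zeta_nat (2 * (r - (Suc r - Suc i)) + 2) * \<tau> ^ (2 * (r - (Suc r - Suc i))))"
    by (rule sum.nat_diff_reindex[symmetric])
  also have "\<dots> = (\<Sum>i<Suc r. ?f (Suc i) / \<tau>\<^sup>2)"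
    unfolding e using \<open>\<tau> \<noteq> 0\<close>
    by (intro sum.cong refl) (auto simp: Suc_diff_le power2_eq_square)
  finally have 1: "(\<Sum>i<Suc r. zeta_nat (2 * i + 2) * zeta_nat (2 * (r - i) + 2) * \<tau> ^ (2 * (r - i)))
      = (\<Sum>i<Suc r. ?f (Suc i)) / \<tau>\<^sup>2"
    unfolding sum_divide_distrib .
  have "(\<Sum>j\<le>r + 2. ?f j) = (\<Sum>j<Suc (Suc r). ?f j) + ?f (r + 2)"
    by (simp add: lessThan_Suc_atMost)
  also have "(\<Sum>j<Suc (Suc r). ?f j) = ?f 0 + (\<Sum>i<Suc r. ?f (Suc i))"
    by (rule sum.lessThan_Suc_shift)
  also have "?f 0 = - zeta_even (r + 2) / 2" by (simp add: zeta_even_0)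
  also have "?f (r + 2) = - zeta_even (r + 2) / 2 * \<tau> ^ (2 * r + 4)"
  proof -
    have "2 * (r + 2) = 2 * r + 4" by simp
    thus ?thesis by (simp only: diff_self_eq_0 zeta_even_0) simp
  qed
  finally have 2: "(\<Sum>i<Suc r. ?f (Suc i)) = (\<Sum>j\<le>r + 2. ?f j) + zeta_even (r + 2) / 2 * (1 + \<tau> ^ (2 * r + 4))"
    by (simp add: algebra_simps)
  have z: "zeta_nat (2 * r + 4) = zeta_even (r + 2)"
  proof -
    have "2 * r + 4 = 2 * (r + 2)" by simp
    thus ?thesis using zeta_nat_even[of "r + 2"] by (simp only:)
  qed
  have "\<tau> ^ (2 * r + 4) = \<tau> * \<tau> ^ (2 * r + 3)" by (simp add: eval_nat_numeral)
  thus ?thesis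
    unfolding cot_series_reciprocity_zeta[OF assms] 1 2 z using \<open>\<tau> \<noteq> 0\<close>
    by (simp add: power2_eq_square divide_simps)
qed

subsection \<open>Lambert series\<close>

lemma powr_minus_of_nat:
  "(of_nat (Suc n) :: complex) powr (- of_nat m) = 1 / of_nat (Suc n) ^ m"
  by (simp add: powr_minus powr_nat' field_simps del: of_nat_Suc)

lemma zeta_of_nat: "zeta (of_nat m) = zeta_nat m"
  unfolding zeta_def zeta_nat_def powr_minus_of_nat ..

text \<open>The bound \<open>1 - norm q\<close> from below for every denominator leaves a geometric
  majorant.\<close>

lemma lambert_series_sums:
  fixes q :: complex
  assumes "norm q < 1"
  shows "(\<lambda>n. q ^ Suc n / (1 - q ^ Suc n) / of_nat (Suc n) ^ m) sums lambert_series q (- of_nat m)"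
proof -
  have "summable (\<lambda>n. q ^ Suc n / (1 - q ^ Suc n) / of_nat (Suc n) ^ m)"
  proof (rule summable_comparison_test')
    show "summable (\<lambda>n. norm q * norm q ^ n / (1 - norm q))"
      using assms by (intro summable_divide summable_mult summable_geometric) simp
    fix n
    have "norm (q ^ Suc n) \<le> norm q"
      unfolding norm_power using assms power_decreasing[of 1 "Suc n" "norm q"] by simp
    hence "1 - norm q \<le> norm (1 - q ^ Suc n)"
      using norm_triangle_ineq2[of 1 "q ^ Suc n"] by simp
    hence "norm (q ^ Suc n / (1 - q ^ Suc n)) \<le> norm q ^ Suc n / (1 - norm q)"
      unfolding norm_divide norm_power using assms by (intro divide_left_mono mult_pos_pos) auto
    moreover have "norm (q ^ Suc n / (1 - q ^ Suc n)) / real (Suc n) ^ m \<le> norm (q ^ Suc n / (1 - q ^ Suc n)) / 1"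
      by (intro divide_left_mono one_le_power) auto
    ultimately show "norm (q ^ Suc n / (1 - q ^ Suc n) / of_nat (Suc n) ^ m) \<le> norm q * norm q ^ n / (1 - norm q)"
      by (simp add: norm_divide norm_mult norm_power del: of_nat_Suc)
  qed
  moreover have "lambert_series q (- of_nat m) = (\<Sum>n. q ^ Suc n / (1 - q ^ Suc n) / of_nat (Suc n) ^ m)"
    unfolding lambert_series_def powr_minus_of_nat by (simp add: mult_ac)
  ultimately show ?thesis by (simp add: summable_sums)
qed

text \<open>All coefficients are real. This gives reality at real nomes, and equal real parts at
  \<open>x\<close> and \<open>- x\<close> for a purely imaginary \<open>x\<close>.\<close>

lemma lambert_series_cnj:
  assumes "norm q < 1"
  shows "lambert_series (cnj q) (- of_nat m) = cnj (lambert_series q (- of_nat m))"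
proof (rule sums_unique2)
  show "(\<lambda>n. cnj (q ^ Suc n / (1 - q ^ Suc n) / of_nat (Suc n) ^ m)) sums cnj (lambert_series q (- of_nat m))"
    unfolding sums_cnj by (rule lambert_series_sums) fact
  show "(\<lambda>n. cnj (q ^ Suc n / (1 - q ^ Suc n) / of_nat (Suc n) ^ m)) sums lambert_series (cnj q) (- of_nat m)"
    using lambert_series_sums[of "cnj q" m] assms by simp
qed

text \<open>For \<open>f u = u / (1 - u)\<close> one has
  \<open>f u + f (- u) = 2 * f (u\<^sup>2)\<close>. Hence after subtracting
  \<open>2 * L (x ^ 2)\<close> the terms of odd summation index vanish, and those of even index
  \<open>2 * N\<close> form series in \<open>x ^ 2\<close> and \<open>x ^ 4\<close> with the factor
  \<open>1 / 2 ^ m\<close>.\<close>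

lemma lambert_series_duplication:
  fixes x :: complex and m :: nat
  assumes "norm x < 1"
  defines "L \<equiv> \<lambda>q. lambert_series q (- of_nat m)"
  shows "L x + L (- x) = (2 + 2 / 2 ^ m) * L (x ^ 2) - 2 / 2 ^ m * L (x ^ 4)"
proof -
  define f :: "complex \<Rightarrow> complex" where "f = (\<lambda>u. u / (1 - u))"
  have small: "norm (x ^ j) < 1" if "j > 0" for j
    using assms that by (simp add: norm_power power_less_one_iff)
  have L: "(\<lambda>n. f (q ^ Suc n) / of_nat (Suc n) ^ m) sums L q" if "norm q < 1" for q
    unfolding L_def f_def by (rule lambert_series_sums) fact
  have f: "f u + f (- u) = 2 * f (u\<^sup>2)" if "norm u < 1" for u
  proof -
    have "u \<noteq> 1" "u \<noteq> - 1" using that by auto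
    hence "1 - u \<noteq> 0" "1 + u \<noteq> 0"
      by (simp_all add: eq_neg_iff_add_eq_0 add.commute)
    moreover have "1 - u\<^sup>2 = (1 - u) * (1 + u)" by (simp add: power2_eq_square algebra_simps)
    ultimately show ?thesis
      unfolding f_def by (simp add: divide_simps) (simp add: algebra_simps power2_eq_square)
  qed
  \<comment> \<open>The summation index is \<open>Suc n\<close>, so \<open>odd n\<close> selects the
    even indices.\<close>
  let ?g = "\<lambda>n. if odd n then 2 * ((f (x ^ Suc n) - f (x ^ (2 * Suc n))) / of_nat (Suc n) ^ m) else 0"
  have "(\<lambda>n. f (x ^ Suc n) / of_nat (Suc n) ^ m + f ((- x) ^ Suc n) / of_nat (Suc n) ^ m) sums (L x + L (- x))"
    using assms by (intro sums_add L) auto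
  moreover have "(\<lambda>n. 2 * (f ((x ^ 2) ^ Suc n) / of_nat (Suc n) ^ m)) sums (2 * L (x ^ 2))"
    by (intro sums_mult L small) simp
  ultimately have "(\<lambda>n. (f (x ^ Suc n) / of_nat (Suc n) ^ m + f ((- x) ^ Suc n) / of_nat (Suc n) ^ m)
           - 2 * (f ((x ^ 2) ^ Suc n) / of_nat (Suc n) ^ m)) sums (L x + L (- x) - 2 * L (x ^ 2))"
    by (rule sums_diff)
  moreover have "(f (x ^ Suc n) / of_nat (Suc n) ^ m + f ((- x) ^ Suc n) / of_nat (Suc n) ^ m)
           - 2 * (f ((x ^ 2) ^ Suc n) / of_nat (Suc n) ^ m) = ?g n" for n
  proof (cases "odd n")
    case True
    hence "(- x) ^ Suc n = x ^ Suc n" by simp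
    moreover have "(x ^ 2) ^ Suc n = x ^ (2 * Suc n)" by (simp only: power_mult)
    ultimately show ?thesis using True by (simp add: diff_divide_distrib del: power_Suc of_nat_Suc)
  next
    case False
    hence m: "(- x) ^ Suc n = - (x ^ Suc n)" by simp
    have s: "(x ^ 2) ^ Suc n = (x ^ Suc n)\<^sup>2" by (simp only: power_mult[symmetric] mult.commute)
    show ?thesis using False f[OF small[of "Suc n"]] unfolding m s
      by (simp add: add_divide_distrib[symmetric] del: power_Suc of_nat_Suc)
  qed
  ultimately have "?g sums (L x + L (- x) - 2 * L (x ^ 2))" by simp
  also have "?g sums (L x + L (- x) - 2 * L (x ^ 2)) \<longleftrightarrow>
             (\<lambda>l. ?g (2 * l + 1)) sums (L x + L (- x) - 2 * L (x ^ 2))"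
    by (rule sums_mono_reindex[symmetric]) (auto simp: strict_mono_def elim!: oddE)
  finally have 1: "(\<lambda>l. ?g (2 * l + 1)) sums (L x + L (- x) - 2 * L (x ^ 2))" .
  have "(\<lambda>l. 2 / 2 ^ m * (f ((x ^ 2) ^ Suc l) / of_nat (Suc l) ^ m - f ((x ^ 4) ^ Suc l) / of_nat (Suc l) ^ m))
        sums (2 / 2 ^ m * (L (x ^ 2) - L (x ^ 4)))"
    by (intro sums_mult sums_diff L small) simp_all
  moreover have "2 / 2 ^ m * (f ((x ^ 2) ^ Suc l) / of_nat (Suc l) ^ m - f ((x ^ 4) ^ Suc l) / of_nat (Suc l) ^ m)
      = ?g (2 * l + 1)" for l
  proof -
    have p: "(x ^ 2) ^ Suc l = x ^ Suc (2 * l + 1)" "(x ^ 4) ^ Suc l = x ^ (2 * Suc (2 * l + 1))"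
    proof -
      have "2 * Suc l = Suc (2 * l + 1)" "4 * Suc l = 2 * Suc (2 * l + 1)" by simp_all
      thus "(x ^ 2) ^ Suc l = x ^ Suc (2 * l + 1)" "(x ^ 4) ^ Suc l = x ^ (2 * Suc (2 * l + 1))"
        by (simp_all only: power_mult[symmetric])
    qed
    have n: "(of_nat (Suc (2 * l + 1)) :: complex) = 2 * of_nat (Suc l)" by simp
    show ?thesis unfolding p n power_mult_distrib
      by (simp add: diff_divide_distrib right_diff_distrib del: power_Suc of_nat_Suc)
  qed
  ultimately have 2: "(\<lambda>l. ?g (2 * l + 1)) sums (2 / 2 ^ m * (L (x ^ 2) - L (x ^ 4)))" by simp
  from sums_unique2[OF 1 2] show ?thesis by (simp add: algebra_simps)
qed

lemma lambert_series_conv_cot_series: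
  assumes "Im \<tau> > 0"
  shows "lambert_series (exp (2 * of_real pi * \<i> * \<tau>)) (- of_nat (2 * r + 3))
           = (\<i> * cot_series (2 * r + 3) \<tau> - zeta_nat (2 * r + 3)) / 2"
proof (rule sums_unique2)
  let ?q = "exp (2 * of_real pi * \<i> * \<tau>)" and ?m = "2 * r + 3"
  have "norm ?q < 1" using assms by simp
  thus "(\<lambda>n. ?q ^ Suc n / (1 - ?q ^ Suc n) / of_nat (Suc n) ^ ?m) sums lambert_series ?q (- of_nat ?m)"
    by (rule lambert_series_sums)
  have nz: "Im \<tau> \<noteq> 0" using assms by simp
  have "(\<lambda>n. (\<i> * (cot (of_real pi * (of_nat (Suc n) * \<tau>)) / of_nat (Suc n) ^ ?m) - 1 / of_nat (Suc n) ^ ?m) / 2)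
          sums ((\<i> * cot_series ?m \<tau> - zeta_nat ?m) / 2)"
    unfolding cot_series_def
    by (intro sums_divide sums_diff sums_mult zeta_nat_sums summable_sums cot_double_sum(2)[OF nz]) simp
  moreover have "(\<i> * (cot (of_real pi * (of_nat (Suc n) * \<tau>)) / of_nat (Suc n) ^ ?m) - 1 / of_nat (Suc n) ^ ?m) / 2
      = ?q ^ Suc n / (1 - ?q ^ Suc n) / of_nat (Suc n) ^ ?m" for n
  proof -
    define w where "w = of_real pi * (of_nat (Suc n) * \<tau>)"
    have sin: "sin w \<noteq> 0"
      unfolding w_def by (intro sin_pi_times_nonzero of_nat_mult_notin_Ints nz)
    have q: "?q ^ Suc n = exp (2 * \<i> * w)"
      unfolding exp_of_nat_mult[symmetric] w_def by (simp only: mult_ac)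
    define Q where "Q = exp (2 * \<i> * w)"
    have "Q \<noteq> 1" and cot: "cot w = \<i> * (Q + 1) / (Q - 1)"
      unfolding Q_def by (rule cot_conv_exp[OF sin])+
    have "(\<i> * cot w - 1) / 2 = Q / (1 - Q)"
      unfolding cot using \<open>Q \<noteq> 1\<close> by (simp add: divide_simps) (simp add: algebra_simps)
    moreover have "(\<i> * (cot w / of_nat (Suc n) ^ ?m) - 1 / of_nat (Suc n) ^ ?m) / 2
       = (\<i> * cot w - 1) / 2 / of_nat (Suc n) ^ ?m"
      by (simp add: diff_divide_distrib mult.commute)
    ultimately show ?thesis unfolding q w_def[symmetric] Q_def[symmetric] by (simp only:)
  qed
  ultimately show "(\<lambda>n. ?q ^ Suc n / (1 - ?q ^ Suc n) / of_nat (Suc n) ^ ?m)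
          sums ((\<i> * cot_series ?m \<tau> - zeta_nat ?m) / 2)" by simp
qed

lemma lambert_series_of_real:
  assumes "\<bar>q\<bar> < 1"
  shows "lambert_series (of_real q) (- of_nat m) = of_real (Re (lambert_series (of_real q) (- of_nat m)))"
proof -
  have "cnj (lambert_series (of_real q) (- of_nat m)) = lambert_series (cnj (of_real q)) (- of_nat m)"
    by (rule lambert_series_cnj[symmetric]) (use assms in simp)
  hence "lambert_series (of_real q) (- of_nat m) \<in> \<real>"
    unfolding complex_cnj_complex_of_real Reals_cnj_iff .
  thus ?thesis by (rule of_real_Re[symmetric])
qed

lemma zeta_nat_real: "m \<ge> 2 \<Longrightarrow> zeta_nat m = of_real (Re (zeta_nat m))"
proof -
  assume "m \<ge> 2"
  have "(\<lambda>n. cnj (1 / of_nat (Suc n) ^ m)) sums cnj (zeta_nat m)"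
    unfolding sums_cnj by (rule zeta_nat_sums) fact
  hence "(\<lambda>n. 1 / of_nat (Suc n) ^ m) sums cnj (zeta_nat m)"
    by simp
  from sums_unique2[OF this zeta_nat_sums[OF \<open>m \<ge> 2\<close>]] have "zeta_nat m \<in> \<real>"
    unfolding Reals_cnj_iff .
  thus "zeta_nat m = of_real (Re (zeta_nat m))" by (rule of_real_Re[symmetric])
qed

section \<open>Ramanujan's formula for Lambert series\<close>

lemma zeta_even_product:
  assumes "j \<le> n"
  shows "zeta_even j * zeta_even (n - j) = of_real ((-1) ^ n * (2 * pi) ^ (2 * n) / 4 *
           (bernoulli (2 * j) * bernoulli (2 * n - 2 * j) / (fact (2 * j) * fact (2 * n - 2 * j))))"
proof -
  have e: "2 * (n - j) = 2 * n - 2 * j" by simp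
  \<comment> \<open>The sign and the power of \<open>2 * pi\<close> in the product depend on
    \<open>n\<close> alone.\<close>
  have "(-1 :: real) ^ (j + 1) * (-1) ^ (n - j + 1) = (-1) ^ n"
    unfolding power_add[symmetric] using assms by (simp add: uminus_power_if)
  moreover have "(2 * pi) ^ (2 * j) * (2 * pi) ^ (2 * n - 2 * j) = (2 * pi) ^ (2 * n)"
    unfolding power_add[symmetric] using assms by simp
  ultimately have "(-1) ^ n * (2 * pi) ^ (2 * n) / 4 *
           (bernoulli (2 * j) * bernoulli (2 * n - 2 * j) / (fact (2 * j) * fact (2 * n - 2 * j)))
        = ((-1 :: real) ^ (j + 1) * (-1) ^ (n - j + 1)) * ((2 * pi) ^ (2 * j) * (2 * pi) ^ (2 * n - 2 * j)) / 4 *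
           (bernoulli (2 * j) * bernoulli (2 * n - 2 * j) / (fact (2 * j) * fact (2 * n - 2 * j)))"
    by simp
  also have "\<dots> = ((-1) ^ (j + 1) * (2 * pi) ^ (2 * j) * bernoulli (2 * j) / (2 * fact (2 * j))) *
     ((-1) ^ (n - j + 1) * (2 * pi) ^ (2 * n - 2 * j) * bernoulli (2 * n - 2 * j) / (2 * fact (2 * n - 2 * j)))"
    by (simp only: times_divide_times_eq times_divide_eq_left times_divide_eq_right mult_ac divide_divide_eq_left)
  finally have *: "(-1) ^ n * (2 * pi) ^ (2 * n) / 4 *
           (bernoulli (2 * j) * bernoulli (2 * n - 2 * j) / (fact (2 * j) * fact (2 * n - 2 * j))) = \<dots>" .
  show ?thesis
    unfolding zeta_even_def e of_real_mult[symmetric] * ..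
qed

lemma lambert_series_reciprocity:
  fixes \<tau> :: complex and r :: nat
  assumes "Im \<tau> > 0"
  defines "L \<equiv> \<lambda>\<tau>. lambert_series (exp (2 * of_real pi * \<i> * \<tau>)) (- of_nat (2 * r + 3))"
  shows "2 * L \<tau> + zeta_nat (2 * r + 3) - \<tau> ^ (2 * r + 2) * (2 * L (- 1 / \<tau>) + zeta_nat (2 * r + 3))
           = - (2 / of_real pi) * (\<Sum>j\<le>r + 2. \<i> / \<tau> * (zeta_even j * zeta_even (r + 2 - j) * \<tau> ^ (2 * j)))"
proof -
  have nz: "\<tau> \<noteq> 0" "Im \<tau> \<noteq> 0" using assms by auto
  have Im': "Im (- 1 / \<tau>) > 0"
    using assms nz(1) by (auto simp: Im_divide complex_eq_iff intro!: divide_pos_pos add_nonneg_pos)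
  let ?C = "cot_series (2 * r + 3)" and ?Z = "zeta_nat (2 * r + 3)"
  let ?S = "\<Sum>j\<le>r + 2. zeta_even j * zeta_even (r + 2 - j) * \<tau> ^ (2 * j)"
  have 1: "\<i> * ?C \<tau> = 2 * L \<tau> + ?Z"
    unfolding L_def lambert_series_conv_cot_series[OF assms(1)] by (simp add: field_simps)
  have 2: "\<i> * ?C (- 1 / \<tau>) = 2 * L (- 1 / \<tau>) + ?Z"
    unfolding L_def lambert_series_conv_cot_series[OF Im'] by (simp add: field_simps)
  have m: "?C (1 / \<tau>) = - ?C (- 1 / \<tau>)"
    using cot_series_minus[of "- 1 / \<tau>" r] Im' by simp
  have alg: "\<i> * X - t * (\<i> * Y) = - (2 / of_real pi) * (\<i> / \<tau> * S)"
    if "of_real pi * (X + t * (- Y)) = - (2 / \<tau>) * S" for X Y S t :: complex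
  proof -
    have "X - t * Y = - (2 / \<tau>) * S / of_real pi"
      by (subst nonzero_eq_divide_eq) (use that in \<open>simp_all add: mult.commute\<close>)
    hence "\<i> * (X - t * Y) = \<i> * (- (2 / \<tau>) * S / of_real pi)" by (rule arg_cong)
    thus ?thesis by (simp add: right_diff_distrib mult_ac)
  qed
  have "\<i> * ?C \<tau> - \<tau> ^ (2 * r + 2) * (\<i> * ?C (- 1 / \<tau>)) = - (2 / of_real pi) * (\<i> / \<tau> * ?S)"
    by (rule alg) (rule cot_series_reciprocity[OF nz(2), of r, unfolded m])
  thus ?thesis unfolding 1 2 sum_distrib_left .
qed

subsection \<open>The relation at the quadratic irrationality\<close>

lemma two_powi_minus_even: "2 powi (- 2 * int j + 2) = (4 :: real) / 2 ^ (2 * j)"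
proof -
  have "2 powi (- 2 * int j + 2) = (2 :: real) powi (2 - int (2 * j))" by simp
  also have "\<dots> = 2 powi 2 / 2 powi (int (2 * j))" by (rule power_int_diff) simp
  finally show ?thesis by (simp only: power_int_of_nat) simp
qed

text \<open>Pairs the indices \<open>j\<close> and \<open>2 * k - j\<close>. At \<open>j = k\<close>
  the pair is a single index counted twice, which is the origin of the Kronecker delta in
  \<open>coeff_c\<close>.\<close>

lemma sum_atMost_double_fold:
  fixes h :: "nat \<Rightarrow> real"
  shows "(\<Sum>j\<le>2 * k. h j) = (\<Sum>j=0..k. (h j + h (2 * k - j)) / (1 + of_bool (j = k)))"
proof -
  have split: "{..2 * k} = insert k ({..<k} \<union> {k<..2 * k})" by auto
  have "(\<Sum>j\<le>2 * k. h j) = h k + ((\<Sum>j<k. h j) + (\<Sum>j\<in>{k<..2 * k}. h j))"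
    unfolding split by (subst sum.insert, simp, simp, subst sum.union_disjoint) auto
  also have "(\<Sum>j\<in>{k<..2 * k}. h j) = (\<Sum>j<k. h (2 * k - j))"
    by (rule sum.reindex_bij_witness[of _ "\<lambda>j. 2 * k - j" "\<lambda>j. 2 * k - j"]) auto
  also have "h k + ((\<Sum>j<k. h j) + (\<Sum>j<k. h (2 * k - j))) = (\<Sum>j<k. h j + h (2 * k - j)) + h k"
    by (simp add: sum.distrib)
  also have "\<dots> = (\<Sum>j<Suc k. (h j + h (2 * k - j)) / (1 + of_bool (j = k)))"
    by (auto intro!: sum.cong)
  also have "{..<Suc k} = {0..k}" by auto
  finally show ?thesis .
qed

section \<open>The angle \<theta> and the coefficients\<close>

lemma cos_sin_of_cot_sqrt7:
  fixes \<theta> :: real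
  assumes "0 < \<theta>" and "\<theta> < pi / 2" and "cot \<theta> = sqrt 7"
  shows "sin \<theta> = 1 / (2 * sqrt 2)" and "cos \<theta> = sqrt 7 / (2 * sqrt 2)"
proof -
  have s: "sin \<theta> > 0" using assms by (intro sin_gt_zero) auto
  have "cos \<theta> / sin \<theta> = sqrt 7" using assms(3) by (simp only: cot_def)
  hence c: "cos \<theta> = sqrt 7 * sin \<theta>" using s by (simp only: divide_eq_eq split: if_splits)
  have "(sqrt 7 * sin \<theta>)\<^sup>2 = 7 * (sin \<theta>)\<^sup>2" by (simp add: power_mult_distrib)
  hence "8 * (sin \<theta>)\<^sup>2 = 1"
    using sin_cos_squared_add[of \<theta>] unfolding c by linarith
  hence "(2 * sqrt 2 * sin \<theta>)\<^sup>2 = 1\<^sup>2"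
    by (simp only: power_mult_distrib) simp
  hence "2 * sqrt 2 * sin \<theta> = 1"
    by (rule power2_eq_imp_eq) (use s in simp_all)
  thus sin: "sin \<theta> = 1 / (2 * sqrt 2)" by (simp add: eq_divide_eq mult_ac)
  show "cos \<theta> = sqrt 7 / (2 * sqrt 2)" unfolding c sin by simp
qed

text \<open>The two cosines in \<open>coeff_c\<close> are the contributions of \<open>j\<close> and
  \<open>2 * k - j\<close> to Ramanujan's sum; \<open>g j\<close> is the negative real part of
  \<open>\<i> / v * v ^ (2 * j)\<close> for \<open>v = \<i> * cis \<theta> / sqrt 2\<close>. The
  signs agree because the two indices have the same parity.\<close>

lemma coeff_c_conv:
  fixes \<theta> :: real and j k :: nat
  assumes "j \<le> k"
  defines "g \<equiv> \<lambda>j::nat. (-1) ^ (j + 1) * sqrt 2 / 2 ^ j * cos ((2 * real j - 1) * \<theta>)"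
  shows "(-1) ^ (j + 1) * coeff_c \<theta> j k
           = 2 ^ (2 * k) / coeff_a \<theta> k * ((g j + g (2 * k - j)) / (1 + of_bool (j = k)))"
proof -
  have p1: "2 powr (2 * real k + 1 / 2 - real j) = 2 ^ (2 * k) * sqrt 2 / 2 ^ j"
    using powr_realpow[of 2 "2 * k"] powr_realpow[of 2 j]
    by (simp add: powr_diff powr_add powr_half_sqrt)
  have p2: "2 powr (real j + 1 / 2) = 2 ^ j * sqrt 2"
    by (simp add: powr_add powr_half_sqrt powr_realpow)
  have s: "(-1 :: real) ^ (2 * k - j + 1) = (-1) ^ (j + 1)"
    using assms by (simp add: uminus_power_if)
  have r: "2 * real (2 * k - j) - 1 = 4 * real k - 1 - 2 * real j"
    using assms by (simp add: of_nat_diff)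
  have q: "(2 :: real) ^ (2 * k - j) = 2 ^ (2 * k) / 2 ^ j"
    using assms by (simp add: power_diff)
  have "2 ^ (2 * k) * (g j + g (2 * k - j)) = (-1) ^ (j + 1) *
       (2 powr (2 * real k + 1 / 2 - real j) * cos ((2 * real j - 1) * \<theta>)
      + 2 powr (real j + 1 / 2) * cos ((4 * real k - 1 - 2 * real j) * \<theta>))"
    unfolding g_def s r q p1 p2 by (simp add: algebra_simps)
  thus ?thesis unfolding coeff_c_def by simp
qed

text \<open>Expanding at \<open>y = 4 * k * \<theta>\<close>, both trigonometric expressions equal
  \<open>sqrt 7 * sin y + 3 * cos y\<close>. In this form \<open>coeff_b\<close> is the coefficient
  that appears when the relations are combined.\<close>

lemma coeff_b_conv:
  fixes \<theta> :: real
  assumes "0 < \<theta>" and "\<theta> < pi / 2" and "cot \<theta> = sqrt 7"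
  shows "coeff_b \<theta> k = 2 * 2 ^ (2 * k) + 4 / 2 ^ (2 * k) + 4 * cos ((4 * real k - 2) * \<theta>)"
proof -
  note sc = cos_sin_of_cot_sqrt7[OF assms]
  have p: "2 powr (3 / 2) = 2 * sqrt 2"
    using powr_add[of "2 :: real" 1 "1 / 2"] by (simp add: powr_half_sqrt)
  define y where "y = 4 * real k * \<theta>"
  have a1: "(4 * real k + 1) * \<theta> = y + \<theta>" and a2: "(4 * real k - 2) * \<theta> = y - 2 * \<theta>"
    by (simp_all add: y_def algebra_simps)
  have s2: "sin (2 * \<theta>) = sqrt 7 / 4" and c2: "cos (2 * \<theta>) = 3 / 4"
    by (simp_all add: sin_double cos_double sc power_divide power_mult_distrib)
  have "2 * sqrt 2 * sin (y + \<theta>) + 2 * cos y = 4 * cos (y - 2 * \<theta>)"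
    unfolding sin_add cos_diff s2 c2 sc by (simp add: algebra_simps)
  thus ?thesis unfolding coeff_b_def two_powi_minus_even p a1 a2 y_def[symmetric] by simp
qed

lemma lambert_series_imaginary_quadratic_relation:
  fixes \<theta> :: real and k :: nat
  assumes "0 < \<theta>" and "\<theta> < pi / 2" and "cot \<theta> = sqrt 7" and "k \<ge> 1"
  defines "m \<equiv> 4 * k - 1"
  defines "L \<equiv> \<lambda>q. Re (lambert_series q (- of_nat m))" and "Z \<equiv> Re (zeta_nat m)"
  defines "y \<equiv> exp (- sqrt 7 * pi)"
  defines "s \<equiv> \<lambda>j. bernoulli (2 * j) * bernoulli (4 * k - 2 * j) / (fact (2 * j) * fact (4 * k - 2 * j))"
  shows "(2 + 4 / 2 ^ (4 * k)) * L (of_real (- y)) - 4 / 2 ^ (4 * k) * L (of_real (y ^ 2)) + Z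
           = - (2 / 2 ^ (2 * k)) * cos ((4 * real k - 2) * \<theta>) * (2 * L (of_real (- y)) + Z)
             + (2 * pi) ^ m * (\<Sum>j\<le>2 * k. (-1) ^ (j + 1) * sqrt 2 / 2 ^ j * cos ((2 * real j - 1) * \<theta>) * s j)"
proof -
  \<comment> \<open>Matches the odd exponent \<open>2 * r + 3\<close> of the general formulas with
    \<open>m\<close>; the truncated subtractions are exact because \<open>k \<ge> 1\<close>.\<close>
  define r where "r = 2 * k - 2"
  have r: "2 * r + 3 = m" "r + 2 = 2 * k" "2 * r + 2 = 2 * (2 * k - 1)"
    using assms(4) by (auto simp: r_def m_def)
  note sc = cos_sin_of_cot_sqrt7[OF assms(1-3)]
  define v where "v = Complex (- 1 / 4) (sqrt 7 / 4)"
  define \<alpha> where "\<alpha> = Complex (1 / 2) (sqrt 7 / 2)"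
  have "v \<noteq> 0" by (simp add: v_def complex_eq_iff)
  have "v * \<alpha> = - 1" by (simp add: v_def \<alpha>_def complex_eq_iff)
  hence inv: "- 1 / v = \<alpha>" using \<open>v \<noteq> 0\<close> by (simp add: field_simps)
  have polar: "v = \<i> * cis \<theta> / of_real (sqrt 2)"
    by (simp add: v_def complex_eq_iff sc)
  have v2: "v ^ (2 * j) = of_real ((- 1 / 2) ^ j) * cis (2 * real j * \<theta>)" for j
  proof -
    have "v\<^sup>2 = of_real (- 1 / 2) * cis (2 * \<theta>)"
    proof -
      have "(cis \<theta>)\<^sup>2 = cis (2 * \<theta>)" by (simp add: power2_eq_square cis_mult)
      moreover have "(complex_of_real (sqrt 2))\<^sup>2 = 2" by (simp flip: of_real_power)
      ultimately show ?thesis unfolding polar by (simp add: power_divide power_mult_distrib)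
    qed
    hence "v ^ (2 * j) = of_real ((- 1 / 2) ^ j) * cis (2 * \<theta>) ^ j"
      by (simp only: power_mult power_mult_distrib of_real_power)
    moreover have "cis (2 * \<theta>) ^ j = cis (2 * real j * \<theta>)"
      unfolding Complex.DeMoivre by (simp add: mult_ac)
    ultimately show ?thesis by simp
  qed
  have iv: "\<i> / v = of_real (sqrt 2) * cis (- \<theta>)"
  proof -
    have "cis \<theta> * cis (- \<theta>) = 1" by (simp add: cis_mult)
    hence "\<i> = of_real (sqrt 2) * cis (- \<theta>) * v"
      unfolding polar by (simp add: mult_ac)
    thus ?thesis using \<open>v \<noteq> 0\<close> by (simp add: nonzero_divide_eq_eq)
  qed

  define x where "x = exp (2 * of_real pi * \<i> * v)"
  have w: "2 * of_real pi * \<i> * v = Complex (- pi * sqrt 7 / 2) (- pi / 2)"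
    by (simp add: v_def complex_eq_iff)
  \<comment> \<open>The real part \<open>- 1 / 4\<close> of \<open>v\<close> contributes the phase
    \<open>- \<i>\<close>. So \<open>- x\<close> is the conjugate of \<open>x\<close>, and
    \<open>x ^ 2\<close> is the negative nome of \<open>\<alpha>\<close>.\<close>
  have x: "x = of_real (exp (- pi * sqrt 7 / 2)) * (- \<i>)"
    unfolding x_def w exp_eq_polar by (simp add: complex_eq_iff cis.ctr)
  have x2: "x ^ 2 = of_real (- y)"
    unfolding x y_def by (simp add: power_mult_distrib mult.commute flip: exp_of_nat_mult of_real_power)
  have x4: "x ^ 4 = of_real (y ^ 2)"
    using arg_cong[OF x2, of "\<lambda>u. u ^ 2"] by (simp flip: power_mult)
  have cnj: "- x = cnj x" unfolding x by simp
  have "norm x < 1" unfolding x by (simp add: norm_mult)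
  have q\<alpha>: "exp (2 * of_real pi * \<i> * \<alpha>) = of_real (- y)"
  proof -
    have "2 * of_real pi * \<i> * \<alpha> = Complex (- sqrt 7 * pi) pi"
      by (simp add: \<alpha>_def complex_eq_iff)
    note * = this
    show ?thesis unfolding * y_def exp_eq_polar by (simp add: complex_eq_iff)
  qed
  have "y < 1" "y > 0" by (simp_all add: y_def)
  hence A: "lambert_series (of_real (- y)) (- of_nat m) = of_real (L (of_real (- y)))"
    unfolding L_def by (intro lambert_series_of_real) simp
  have Z: "zeta_nat m = of_real Z"
    unfolding Z_def using assms(4) by (intro zeta_nat_real) (auto simp: m_def)

  \<comment> \<open>Conjugation gives \<open>L (- x) = L x\<close>, so the left side of the
    duplication formula becomes \<open>2 * L x\<close>.\<close>
  have dup: "2 * L x = (2 + 4 / 2 ^ (4 * k)) * L (of_real (- y)) - 4 / 2 ^ (4 * k) * L (of_real (y ^ 2))"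
  proof -
    have "(2 :: real) * 2 ^ m = 2 ^ (4 * k)"
      using assms(4) unfolding m_def by (simp flip: power_Suc)
    hence c: "2 / 2 ^ m = (4 / 2 ^ (4 * k) :: real)" by (simp add: field_simps)
    have "2 / 2 ^ m = complex_of_real (2 / 2 ^ m)" by simp
    note c' = this[unfolded c]
    have "L x + L (- x) = Re (lambert_series x (- of_nat m) + lambert_series (- x) (- of_nat m))"
      by (simp add: L_def)
    also have "\<dots> = (2 + 4 / 2 ^ (4 * k)) * L (of_real (- y)) - 4 / 2 ^ (4 * k) * L (of_real (y ^ 2))"
      unfolding lambert_series_duplication[OF \<open>norm x < 1\<close>] x2 x4 c' L_def minus_complex.sel
      by (simp only: Re_complex_of_real Im_complex_of_real times_complex.sel mult_zero_left diff_0_right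
          plus_complex.sel complex_Re_numeral complex_Im_numeral add_0_left)
    also have "L (- x) = L x"
      unfolding cnj L_def lambert_series_cnj[OF \<open>norm x < 1\<close>] by simp
    finally show ?thesis by simp
  qed

  define T where "T = (\<lambda>j. \<i> / v * (zeta_even j * zeta_even (2 * k - j) * v ^ (2 * j)))"
  \<comment> \<open>The constants combine as
    \<open>(2 / pi) * (2 * pi) ^ (4 * k) / 4 = (2 * pi) ^ m\<close>.\<close>
  have T: "- (2 / pi) * Re (T j) = (2 * pi) ^ m * ((-1) ^ (j + 1) * sqrt 2 / 2 ^ j * cos ((2 * real j - 1) * \<theta>) * s j)"
    if "j \<le> 2 * k" for j
  proof -
    have a: "cis (- \<theta>) * cis (2 * real j * \<theta>) = cis ((2 * real j - 1) * \<theta>)"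
      by (simp add: cis_mult algebra_simps)
    have "T j = of_real (sqrt 2 * ((2 * pi) ^ (4 * k) / 4 * s j) * (- 1 / 2) ^ j) * (cis (- \<theta>) * cis (2 * real j * \<theta>))"
      unfolding T_def iv v2 zeta_even_product[OF that] s_def by (simp add: mult_ac)
    hence "Re (T j) = sqrt 2 * ((2 * pi) ^ (4 * k) / 4 * s j) * (- 1 / 2) ^ j * cos ((2 * real j - 1) * \<theta>)"
      unfolding a by (simp only: times_complex.sel Re_complex_of_real Im_complex_of_real cis.sel)
    moreover have "(2 * pi) ^ (4 * k) = 2 * pi * (2 * pi) ^ m"
    proof -
      have "4 * k = Suc m" using assms(4) by (simp add: m_def)
      thus ?thesis by (simp only: power_Suc)
    qed
    moreover have "(- 1 / 2 :: real) ^ j = (-1) ^ j / 2 ^ j" by (rule power_divide)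
    ultimately have "Re (T j) = sqrt 2 * ((2 * pi * (2 * pi) ^ m) / 4 * s j) * ((-1) ^ j / 2 ^ j) * cos ((2 * real j - 1) * \<theta>)"
      by (simp only:)
    thus ?thesis by simp
  qed
  have "2 * lambert_series x (- of_nat m) + zeta_nat m - v ^ (2 * (2 * k - 1)) * (2 * lambert_series (of_real (- y)) (- of_nat m) + zeta_nat m)
           = - (2 / of_real pi) * (\<Sum>j\<le>2 * k. T j)"
    using lambert_series_reciprocity[of v r] unfolding inv q\<alpha> x_def[symmetric] r T_def
    by (simp add: v_def)
  moreover have "v ^ (2 * (2 * k - 1)) = of_real (- (2 / 2 ^ (2 * k))) * cis ((4 * real k - 2) * \<theta>)"
  proof -
    have "(- 1 / 2 :: real) ^ (2 * k - 1) = - (2 / 2 ^ (2 * k))"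
      using assms(4) by (cases k) (auto simp: power_divide)
    moreover have "2 * real (2 * k - 1) * \<theta> = (4 * real k - 2) * \<theta>"
      using assms(4) by (simp add: of_nat_diff)
    ultimately show ?thesis unfolding v2 by (simp only:)
  qed
  ultimately have *: "2 * lambert_series x (- of_nat m) + of_real Z
      - of_real (- (2 / 2 ^ (2 * k))) * cis ((4 * real k - 2) * \<theta>) * of_real (2 * L (of_real (- y)) + Z)
           = of_real (- (2 / pi)) * (\<Sum>j\<le>2 * k. T j)"
    unfolding A Z by simp
  have Lx: "L x = Re (lambert_series x (- of_nat m))" by (simp add: L_def)
  \<comment> \<open>The values at \<open>\<alpha>\<close> and of zeta are real, so taking real parts
    only turns the \<open>cis\<close> factor of \<open>v ^ (4 * k - 2)\<close> into a
    cosine.\<close>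
  have "2 * L x + Z + 2 / 2 ^ (2 * k) * cos ((4 * real k - 2) * \<theta>) * (2 * L (of_real (- y)) + Z)
          = - (2 / pi) * (\<Sum>j\<le>2 * k. Re (T j))"
    using arg_cong[OF *, of Re] unfolding Lx
    by (simp only: minus_complex.sel plus_complex.sel times_complex.sel Re_complex_of_real
         Im_complex_of_real cis.sel Re_sum complex_Re_numeral complex_Im_numeral) simp
  also have "\<dots> = (2 * pi) ^ m * (\<Sum>j\<le>2 * k. (-1) ^ (j + 1) * sqrt 2 / 2 ^ j * cos ((2 * real j - 1) * \<theta>) * s j)"
    unfolding sum_distrib_left by (intro sum.cong refl T) simp
  finally show ?thesis unfolding dup by simp
qed

theorem theorem5p2:
  fixes \<theta> :: real and k :: nat
  assumes "0 < \<theta>" and "\<theta> < pi / 2" and "cot \<theta> = sqrt 7"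
    and "k \<ge> 1"
  shows "zeta (4 * of_nat k - 1) =
      of_real ((2 * pi) ^ (4 * k - 1) *
        (\<Sum>j = 0..k. (-1) ^ (j + 1) * coeff_c \<theta> j k * bernoulli (2 * j) * bernoulli (4 * k - 2 * j)
                      / (fact (2 * j) * fact (4 * k - 2 * j))))
      + of_real (coeff_b \<theta> k / coeff_a \<theta> k)
        * lambert_series (of_real (exp (- sqrt 7 * pi))) (- 4 * of_nat k + 1)
      - of_real (((2 powi (- 4 * int k + 2) + 2) * coeff_b \<theta> k - 2 powi (- 2 * int k + 2))
                 / coeff_a \<theta> k)
        * lambert_series (of_real (exp (- 2 * sqrt 7 * pi))) (- 4 * of_nat k + 1)
      + of_real (2 powi (- 4 * int k + 2) * coeff_b \<theta> k / coeff_a \<theta> k)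
        * lambert_series (of_real (exp (- 4 * sqrt 7 * pi))) (- 4 * of_nat k + 1)"
proof -
  define m where "m = 4 * k - 1"
  define y where "y = exp (- sqrt 7 * pi)"
  define L where "L = (\<lambda>q. Re (lambert_series q (- of_nat m)))"
  define Z where "Z = Re (zeta_nat m)"
  define P where "P = (2 :: real) ^ (2 * k)"
  define s where "s = (\<lambda>j. bernoulli (2 * j) * bernoulli (4 * k - 2 * j) / (fact (2 * j) * fact (4 * k - 2 * j)))"
  define g where "g = (\<lambda>j::nat. (-1) ^ (j + 1) * sqrt 2 / 2 ^ j * cos ((2 * real j - 1) * \<theta>))"
  define U where "U = (\<Sum>j\<le>2 * k. g j * s j)"
  define a where "a = coeff_a \<theta> k"
  define b where "b = coeff_b \<theta> k"
  define C where "C = cos ((4 * real k - 2) * \<theta>)"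
  have "y > 0" "y < 1" by (simp_all add: y_def)
  have y2: "y ^ 2 < 1" and y4: "y ^ 4 < 1"
    using \<open>y > 0\<close> \<open>y < 1\<close> by (simp_all add: power_less_one_iff)
  have P: "P \<ge> 4"
    using power_increasing[of 2 "2 * k" "2 :: real"] assms(4) by (simp add: P_def)
  have P2: "(2 :: real) ^ (4 * k) = P\<^sup>2" by (simp add: P_def flip: power_mult)
  have a: "a = P + 2 * C" by (simp add: a_def coeff_a_def P_def C_def)
  \<comment> \<open>\<open>P \<ge> 4\<close> dominates \<open>2 * C \<ge> - 2\<close>, so the final
    division is legitimate.\<close>
  have "a > 0" using P cos_ge_minus_one[of "(4 * real k - 2) * \<theta>"] unfolding a C_def by linarith
  have b: "b = 2 * P + 4 / P + 4 * C"
    unfolding b_def P_def C_def by (rule coeff_b_conv[OF assms(1-3)])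
  have powi4: "2 powi (- 4 * int k + 2) = 4 / P\<^sup>2"
    using two_powi_minus_even[of "2 * k"] by (simp add: P2)

  have s_sym: "s (2 * k - j) = s j" if "j \<le> 2 * k" for j
  proof -
    have "2 * (2 * k - j) = 4 * k - 2 * j" "4 * k - 2 * (2 * k - j) = 2 * j" using that by auto
    thus ?thesis unfolding s_def by (simp only: mult.commute)
  qed
  have "(\<Sum>j = 0..k. (-1) ^ (j + 1) * coeff_c \<theta> j k * bernoulli (2 * j) * bernoulli (4 * k - 2 * j)
                      / (fact (2 * j) * fact (4 * k - 2 * j)))
        = (\<Sum>j = 0..k. P / a * ((g j * s j + g (2 * k - j) * s (2 * k - j)) / (1 + of_bool (j = k))))"
  proof (intro sum.cong refl)
    fix j assume "j \<in> {0..k}"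
    hence j: "j \<le> k" "j \<le> 2 * k" by auto
    have "(-1) ^ (j + 1) * coeff_c \<theta> j k * bernoulli (2 * j) * bernoulli (4 * k - 2 * j)
                      / (fact (2 * j) * fact (4 * k - 2 * j)) = (-1) ^ (j + 1) * coeff_c \<theta> j k * s j"
      by (simp add: s_def)
    also have "\<dots> = P / a * ((g j * s j + g (2 * k - j) * s (2 * k - j)) / (1 + of_bool (j = k)))"
      unfolding coeff_c_conv[OF j(1)] s_sym[OF j(2)] P_def a_def g_def
      by (simp only: times_divide_eq_left times_divide_eq_right distrib_right mult.assoc)
    finally show "(-1) ^ (j + 1) * coeff_c \<theta> j k * bernoulli (2 * j) * bernoulli (4 * k - 2 * j)
                      / (fact (2 * j) * fact (4 * k - 2 * j))
        = P / a * ((g j * s j + g (2 * k - j) * s (2 * k - j)) / (1 + of_bool (j = k)))" .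
  qed
  \<comment> \<open>Unfolds the pairing of indices: the sum up to \<open>k\<close> with
    \<open>coeff_c\<close> is the full Ramanujan sum up to \<open>2 * k\<close>.\<close>
  also have "\<dots> = P / a * U"
    unfolding U_def sum_atMost_double_fold sum_distrib_left ..
  finally have sum: "(\<Sum>j = 0..k. (-1) ^ (j + 1) * coeff_c \<theta> j k * bernoulli (2 * j) * bernoulli (4 * k - 2 * j)
                      / (fact (2 * j) * fact (4 * k - 2 * j))) = P / a * U" .

  have rel1: "(2 + 4 / P\<^sup>2) * L (of_real (- y)) - 4 / P\<^sup>2 * L (of_real (y ^ 2)) + Z
           = - (2 / P) * C * (2 * L (of_real (- y)) + Z) + (2 * pi) ^ m * U"
    using lambert_series_imaginary_quadratic_relation[OF assms]
    unfolding L_def Z_def m_def y_def U_def g_def s_def C_def P2 P_def[symmetric] .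

  have real: "lambert_series (of_real q) (- of_nat m) = of_real (L (of_real q))" if "\<bar>q\<bar> < 1" for q
    unfolding L_def using that by (rule lambert_series_of_real)
  \<comment> \<open>Duplication at the real nome \<open>y\<close> trades the negative nome for
    \<open>y\<close>, \<open>y ^ 2\<close> and \<open>y ^ 4\<close>.\<close>
  have rel2: "L (of_real (- y)) = (2 + 4 / P\<^sup>2) * L (of_real (y ^ 2)) - 4 / P\<^sup>2 * L (of_real (y ^ 4)) - L (of_real y)"
  proof -
    have "(2 :: real) * 2 ^ m = 2 ^ (4 * k)"
      using assms(4) unfolding m_def by (simp flip: power_Suc)
    hence c: "2 / 2 ^ m = (4 / P\<^sup>2 :: real)" unfolding P2 using P by (simp add: field_simps)
    have ny: "norm (complex_of_real y) < 1" using \<open>y > 0\<close> \<open>y < 1\<close> by simp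
    have "complex_of_real (L (of_real y) + L (of_real (- y)))
        = of_real ((2 + 2 / 2 ^ m) * L (of_real (y ^ 2)) - 2 / 2 ^ m * L (of_real (y ^ 4)))"
      using lambert_series_duplication[OF ny, of m] real[of y] real[of "- y"] real[of "y ^ 2"] real[of "y ^ 4"]
            \<open>y > 0\<close> \<open>y < 1\<close> y2 y4 by simp
    thus ?thesis unfolding of_real_eq_iff c by simp
  qed

  \<comment> \<open>Multiplying \<open>rel1\<close> by \<open>P\<close> collects
    \<open>P + 2 * C = a\<close> at \<open>Z\<close> and \<open>2 * P + 4 / P + 4 * C = b\<close> at
    \<open>L (- y)\<close>. Substituting \<open>rel2\<close> then produces the three Lambert
    coefficients; \<open>- 4 / P\<close> is the \<open>y ^ 2\<close> term already present in
    \<open>rel1\<close>.\<close>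
  have "a * Z = P * ((2 * pi) ^ m * U) + b * L (of_real y) - ((4 / P\<^sup>2 + 2) * b - 4 / P) * L (of_real (y ^ 2))
          + 4 / P\<^sup>2 * b * L (of_real (y ^ 4))"
  proof -
    define A where "A = L (of_real (- y))"
    have "P * (- (2 / P) * C * (2 * A + Z) + (2 * pi) ^ m * U) = - 2 * C * (2 * A + Z) + P * ((2 * pi) ^ m * U)"
      and "P * ((2 + 4 / P\<^sup>2) * A - 4 / P\<^sup>2 * L (of_real (y ^ 2)) + Z)
             = (2 * P + 4 / P) * A - 4 / P * L (of_real (y ^ 2)) + P * Z"
      using P by (simp_all add: field_simps power2_eq_square)
    moreover have "P * ((2 + 4 / P\<^sup>2) * A - 4 / P\<^sup>2 * L (of_real (y ^ 2)) + Z)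
           = P * (- (2 / P) * C * (2 * A + Z) + (2 * pi) ^ m * U)"
      using rel1 unfolding A_def by simp
    ultimately have "(2 * P + 4 / P) * A - 4 / P * L (of_real (y ^ 2)) + P * Z
        = - 2 * C * (2 * A + Z) + P * ((2 * pi) ^ m * U)" by simp
    hence "a * Z = P * ((2 * pi) ^ m * U) - b * A + 4 / P * L (of_real (y ^ 2))"
      unfolding a b by (simp only: algebra_simps)
    thus ?thesis unfolding A_def rel2 by (simp add: algebra_simps)
  qed
  hence "Z = (P * ((2 * pi) ^ m * U) + b * L (of_real y) - ((4 / P\<^sup>2 + 2) * b - 4 / P) * L (of_real (y ^ 2))
          + 4 / P\<^sup>2 * b * L (of_real (y ^ 4))) / a"
    using \<open>a > 0\<close> by (simp add: field_simps)
  also have "\<dots> = (2 * pi) ^ m * (P / a * U) + b / a * L (of_real y) - ((4 / P\<^sup>2 + 2) * b - 4 / P) / a * L (of_real (y ^ 2))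
          + 4 / P\<^sup>2 * b / a * L (of_real (y ^ 4))"
  proof -
    define w where "w = (4 / P\<^sup>2 + 2) * b - 4 / P"
    show ?thesis
      unfolding w_def[symmetric] by (simp add: add_divide_distrib diff_divide_distrib mult_ac)
  qed
  finally have Z: "Z = \<dots>" .

  have e: "exp (- 2 * sqrt 7 * pi) = y ^ 2" "exp (- 4 * sqrt 7 * pi) = y ^ 4"
    unfolding y_def exp_of_nat_mult[symmetric] by simp_all
  have m: "- 4 * of_nat k + 1 = (- of_nat m :: complex)" "4 * of_nat k - 1 = (of_nat m :: complex)"
    using assms(4) by (simp_all add: m_def of_nat_diff)
  have "zeta_nat m = of_real Z"
    unfolding Z_def using assms(4) by (intro zeta_nat_real) (auto simp: m_def)
  moreover have "lambert_series (of_real y) (- of_nat m) = of_real (L (of_real y))"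
    "lambert_series (of_real (y ^ 2)) (- of_nat m) = of_real (L (of_real (y ^ 2)))"
    "lambert_series (of_real (y ^ 4)) (- of_nat m) = of_real (L (of_real (y ^ 4)))"
    using \<open>y > 0\<close> \<open>y < 1\<close> y2 y4 by (intro real; simp)+
  ultimately show ?thesis
    unfolding m sum e zeta_of_nat two_powi_minus_even powi4 y_def[symmetric] P_def[symmetric] a_def[symmetric] b_def[symmetric] m_def[symmetric]
    using Z by (simp only: of_real_add of_real_diff of_real_mult)
qed

end
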